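(* Let $n\in\mathbb{R}^+\cup\{0\}$. Then for every $f\in D_{HK}$, $\mathcal{D}_a^n\mathcal{J}_a^{n}f=f$.
   Context: Fix real numbers $a<b$. $D$ denotes the distributional derivative on $(a,b)$, $D^m$ its $m$-fold iterate. Let $C_0=\{F\in C[a,b]:F(a)=0\}$. A distribution $f$ on $(a,b)$ is Henstock–Kurzweil integrable if $f=DF$ for some (unique) $F\in C_0$; $\int_c^d f=F(d)-F(c)$. $D_{HK}$ is the space of these with the Alexiewicz norm $\|f\|_A=\sup_{[a,b]}|F|$; $L^1[a,b]$ is dense in it. Riemann–Liouville fractional integral on $D_{HK}$: for $n\ge1$, $\mathcal{J}_a^nf(x)=\frac{1}{\Gamma(n)}\int_a^x(x-t)^{n-1}f(t)\,dt$; for $0<n<1$, $\mathcal{J}_a^nf(x)=\frac{1}{\Gamma(n)}\lim_{k}\int_a^x(x-t)^{n-1}f_k(t)\,dt$ with $(f_k)\subset L^1[a,b]$, $\|f_k-f\|_A\to0$; $\mathcal{J}_a^0=I$. Riemann–Liouville fractional derivative: for $n\ge0$, $m=\lceil n\rceil$, $\mathcal{D}_a^nf=D^m\mathcal{J}_a^{m-n}f$, $\mathcal{D}_a^0=I$. *)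

theory Defs
  imports "HOL-Analysis.Analysis"
begin

text \<open>Distributions on (a,b) are represented as real functionals on functions;
  only their values on test functions matter (equality is deq).\<close>

type_synonym distr = "(real \<Rightarrow> real) \<Rightarrow> real"

definition test_fun :: "real \<Rightarrow> real \<Rightarrow> (real \<Rightarrow> real) \<Rightarrow> bool" where
  "test_fun a b \<phi> \<longleftrightarrow> (\<forall>k x. (deriv ^^ k) \<phi> differentiable (at x)) \<and>
     (\<exists>c d. a < c \<and> d < b \<and> (\<forall>x. x \<notin> {c..d} \<longrightarrow> \<phi> x = 0))"

definition deq :: "real \<Rightarrow> real \<Rightarrow> distr \<Rightarrow> distr \<Rightarrow> bool" where
  "deq a b S T \<longleftrightarrow> (\<forall>\<phi>. test_fun a b \<phi> \<longrightarrow> S \<phi> = T \<phi>)"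

definition dD :: "distr \<Rightarrow> distr" where
  "dD T = (\<lambda>\<phi>. - T (deriv \<phi>))"

definition reg :: "real \<Rightarrow> real \<Rightarrow> (real \<Rightarrow> real) \<Rightarrow> distr" where
  "reg a b F = (\<lambda>\<phi>. integral {a..b} (\<lambda>x. F x * \<phi> x))"

definition dminus :: "distr \<Rightarrow> distr \<Rightarrow> distr" where
  "dminus S T = (\<lambda>\<phi>. S \<phi> - T \<phi>)"

definition C0 :: "real \<Rightarrow> real \<Rightarrow> (real \<Rightarrow> real) set" where
  "C0 a b = {F. continuous_on {a..b} F \<and> F a = 0}"

definition is_prim :: "real \<Rightarrow> real \<Rightarrow> distr \<Rightarrow> (real \<Rightarrow> real) \<Rightarrow> bool" where
  "is_prim a b f F \<longleftrightarrow> F \<in> C0 a b \<and> deq a b f (dD (reg a b F))"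

definition HK :: "real \<Rightarrow> real \<Rightarrow> distr set" where
  "HK a b = {f. \<exists>F. is_prim a b f F}"

definition prim :: "real \<Rightarrow> real \<Rightarrow> distr \<Rightarrow> real \<Rightarrow> real" where
  "prim a b f = (THE F. is_prim a b f F \<and> (\<forall>x. x \<notin> {a..b} \<longrightarrow> F x = 0))"

definition alex :: "real \<Rightarrow> real \<Rightarrow> distr \<Rightarrow> real" where
  "alex a b f = (SUP x\<in>{a..b}. \<bar>prim a b f x\<bar>)"

text \<open>Integral over [c,d] of f times an absolutely continuous multiplier g with derivative g',
  via integration by parts: F g |_c^d - int F dg.\<close>
definition hk_int_mult :: "real \<Rightarrow> real \<Rightarrow> distr \<Rightarrow> (real \<Rightarrow> real) \<Rightarrow> (real \<Rightarrow> real)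
    \<Rightarrow> real \<Rightarrow> real \<Rightarrow> real" where
  "hk_int_mult a b f g g' c d =
     prim a b f d * g d - prim a b f c * g c - integral {c..d} (\<lambda>t. prim a b f t * g' t)"

text \<open>Kernel (x-t)^(n-1) for n >= 1 (with value 1 at t = x when n = 1) and its t-derivative.\<close>
definition kern :: "real \<Rightarrow> real \<Rightarrow> real \<Rightarrow> real" where
  "kern n x t = (if n = 1 then 1 else (x - t) powr (n - 1))"

definition kern' :: "real \<Rightarrow> real \<Rightarrow> real \<Rightarrow> real" where
  "kern' n x t = - (n - 1) * (x - t) powr (n - 2)"

definition RL_big :: "real \<Rightarrow> real \<Rightarrow> real \<Rightarrow> distr \<Rightarrow> distr" where
  "RL_big a b n f = reg a b (\<lambda>x. hk_int_mult a b f (kern n x) (kern' n x) a x / Gamma n)"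

definition RL_L1fun :: "real \<Rightarrow> real \<Rightarrow> (real \<Rightarrow> real) \<Rightarrow> real \<Rightarrow> real" where
  "RL_L1fun a n g x = integral {a..x} (\<lambda>t. (x - t) powr (n - 1) * g t) / Gamma n"

text \<open>Order 0 < n < 1: Alexiewicz-norm limit of J^n f_k over L^1 approximations f_k of f.\<close>
definition RL_small :: "real \<Rightarrow> real \<Rightarrow> real \<Rightarrow> distr \<Rightarrow> distr" where
  "RL_small a b n f = dD (reg a b (THE H. H \<in> C0 a b \<and> (\<forall>x. x \<notin> {a..b} \<longrightarrow> H x = 0) \<and>
     (\<forall>fk :: nat \<Rightarrow> real \<Rightarrow> real.
        (\<forall>k. fk k absolutely_integrable_on {a..b}) \<and>
        (\<lambda>k. alex a b (dminus (reg a b (fk k)) f)) \<longlonglongrightarrow> 0 \<longrightarrow>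
        (\<lambda>k. alex a b (dminus (reg a b (RL_L1fun a n (fk k))) (dD (reg a b H)))) \<longlonglongrightarrow> 0)))"

definition RLJ :: "real \<Rightarrow> real \<Rightarrow> real \<Rightarrow> distr \<Rightarrow> distr" where
  "RLJ a b n f = (if n = 0 then f else if 1 \<le> n then RL_big a b n f else RL_small a b n f)"

definition RLD :: "real \<Rightarrow> real \<Rightarrow> real \<Rightarrow> distr \<Rightarrow> distr" where
  "RLD a b n f = (dD ^^ nat \<lceil>n\<rceil>) (RLJ a b (real (nat \<lceil>n\<rceil>) - n) f)"

end

theory Submission
  imports Defs
begin

text \<open>
  Let \<open>F\<close> be the primitive of \<open>f\<close> and write \<open>J\<^sup>\<alpha> g\<close> for the classical Riemann--Liouville integral
  (\<open>RL_L1fun\<close>) of a function. The distributional fractional integral of order \<open>n > 0\<close> of \<open>f\<close> has the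
  primitive \<open>J\<^sup>n F\<close>, for \<open>n \<ge> 1\<close> by integration by parts, and for \<open>n < 1\<close> because \<open>J\<^sup>n\<close> is bounded in
  the supremum norm and derivatives of polynomials are dense in the Alexiewicz norm. For
  \<open>\<alpha> + \<beta> \<ge> 1\<close>, Fubini and the Beta integral give the semigroup law for \<open>J\<^sup>\<alpha> J\<^sup>\<beta>\<close> on integrable
  functions. Hence, with \<open>m = \<lceil>n\<rceil>\<close>, integrating to order \<open>n\<close> and then to order \<open>m - n\<close> leads to the
  derivative of \<open>J\<^sup>m F\<close>, and \<open>m\<close> further derivatives leave the derivative of \<open>F\<close>, which is \<open>f\<close>.
  Primitives are unique by the du Bois-Reymond lemma.
\<close>

subsection \<open>Bump functions and the du Bois-Reymond lemma\<close>

text \<open>A polynomial factor and a power in the denominator are allowed because this makes the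
  family closed under differentiation.\<close>

definition bump_fun :: "real poly \<Rightarrow> nat \<Rightarrow> real \<Rightarrow> real" where
  "bump_fun p j x =
     (if 0 < x \<and> x < 1 then poly p x / (x * (1 - x)) ^ j * exp (- 1 / (x * (1 - x))) else 0)"

text \<open>Apply \<open>1 + t \<le> exp t\<close> at \<open>t = 1 / (K * q)\<close> with
  \<open>K = Suc k\<close>, raise to the power \<open>K\<close> and invert. So
  \<open>exp (- 1 / q)\<close> is dominated by any chosen power of \<open>q\<close>, which is the
  source of the flatness of the bumps at their end points.\<close>

lemma exp_minus_inverse_le:
  fixes q :: real
  assumes "0 < q"
  shows "exp (- 1 / q) \<le> (real (Suc k) * q) ^ Suc k"
proof -
  let ?K = "real (Suc k)"
  have "1 / (?K * q) \<le> exp (1 / (?K * q))"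
    using exp_ge_add_one_self[of "1 / (?K * q)"] by linarith
  then have "(1 / (?K * q)) ^ Suc k \<le> exp (1 / (?K * q)) ^ Suc k"
    by (rule power_mono) (use assms in simp)
  also have "\<dots> = exp (1 / q)"
    by (simp add: exp_of_nat_mult[symmetric] del: power_Suc of_nat_Suc)
  finally have "inverse (exp (1 / q)) \<le> inverse ((1 / (?K * q)) ^ Suc k)"
    by (rule le_imp_inverse_le) (use assms in simp)
  then show ?thesis
    by (simp add: exp_minus power_divide field_simps del: power_Suc of_nat_Suc)
qed

text \<open>With \<open>q = x * (1 - x)\<close>, estimating the exponential by the power
  \<open>j + 2\<close> of \<open>q\<close> absorbs the denominator \<open>q ^ j\<close> and leaves
  \<open>q\<^sup>2\<close>, while \<open>q\<close> is at most both \<open>x\<close> and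
  \<open>1 - x\<close>. Quadratic decay is just enough to force derivative 0 at the end points 0 and
  1.\<close>

lemma bump_fun_bound: "\<exists>C\<ge>0. \<forall>x. \<bar>bump_fun p j x\<bar> \<le> C * x\<^sup>2 \<and> \<bar>bump_fun p j x\<bar> \<le> C * (x - 1)\<^sup>2"
proof -
  have "bounded (poly p ` {0..1})"
    by (intro compact_imp_bounded compact_continuous_image continuous_intros) auto
  then obtain M where M: "M > 0" "\<And>x. x \<in> {0..1} \<Longrightarrow> \<bar>poly p x\<bar> \<le> M"
    unfolding bounded_pos by auto
  define K where "K = real (Suc (Suc j))"
  have "\<bar>bump_fun p j x\<bar> \<le> M * K ^ (j + 2) * x\<^sup>2 \<and> \<bar>bump_fun p j x\<bar> \<le> M * K ^ (j + 2) * (x - 1)\<^sup>2" for x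
  proof (cases "0 < x \<and> x < 1")
    case True
    define q where "q = x * (1 - x)"
    have q: "0 < q" "q \<le> x" "q \<le> 1 - x"
      using True by (auto simp: q_def mult_left_le mult_left_le_one_le)
    have "exp (- 1 / q) \<le> (K * q) ^ (j + 2)"
      using exp_minus_inverse_le[OF q(1), of "Suc j"] by (simp add: K_def)
    then have "\<bar>poly p x\<bar> / q ^ j * exp (- 1 / q) \<le> M / q ^ j * (K * q) ^ (j + 2)"
      using M(2)[of x] True q by (intro mult_mono divide_right_mono) auto
    also have "\<dots> = M * K ^ (j + 2) * q\<^sup>2"
      using q by (simp add: power_mult_distrib power_add power2_eq_square)
    finally have *: "\<bar>bump_fun p j x\<bar> \<le> M * K ^ (j + 2) * q\<^sup>2"
      using True q unfolding bump_fun_def q_def[symmetric] by (simp add: abs_mult)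
    have "q\<^sup>2 \<le> x\<^sup>2" "q\<^sup>2 \<le> (1 - x)\<^sup>2"
      using q by (auto intro!: power_mono)
    then have "M * K ^ (j + 2) * q\<^sup>2 \<le> M * K ^ (j + 2) * x\<^sup>2"
      "M * K ^ (j + 2) * q\<^sup>2 \<le> M * K ^ (j + 2) * (x - 1)\<^sup>2"
      using M(1) by (auto intro!: mult_left_mono simp: K_def power2_commute)
    with * show ?thesis by linarith
  qed (use M in \<open>auto simp: bump_fun_def K_def\<close>)
  moreover have "M * K ^ (j + 2) \<ge> 0"
    using M by (simp add: K_def)
  ultimately show ?thesis by blast
qed

lemma has_derivative_0_of_quadratic_bound:
  fixes f :: "real \<Rightarrow> real"
  assumes "\<And>y. \<bar>f y\<bar> \<le> C * (y - x)\<^sup>2"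
  shows "(f has_real_derivative 0) (at x)"
proof -
  have fx: "f x = 0" using assms[of x] by simp
  have "((\<lambda>y. (f y - f x) / (y - x)) \<longlongrightarrow> 0) (at x)"
  proof (rule Lim_null_comparison)
    show "\<forall>\<^sub>F y in at x. norm ((f y - f x) / (y - x)) \<le> C * \<bar>y - x\<bar>"
      unfolding eventually_at_filter
    proof (intro always_eventually allI impI)
      fix y assume "y \<noteq> x"
      then have "\<bar>f y\<bar> / \<bar>y - x\<bar> \<le> C * (y - x)\<^sup>2 / \<bar>y - x\<bar>"
        using assms[of y] by (intro divide_right_mono) auto
      also have "\<dots> = C * \<bar>y - x\<bar>"
        using \<open>y \<noteq> x\<close> by (simp add: power2_eq_square field_simps abs_mult_self_eq flip: abs_mult)
      finally show "norm ((f y - f x) / (y - x)) \<le> C * \<bar>y - x\<bar>"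
        by (simp add: fx)
    qed
    show "((\<lambda>y. C * \<bar>y - x\<bar>) \<longlongrightarrow> 0) (at x)"
      by (auto intro!: tendsto_eq_intros)
  qed
  then show ?thesis by (simp add: has_field_derivative_iff)
qed

lemma bump_fun_has_derivative:
  "\<exists>p' j'. \<forall>x. (bump_fun p j has_real_derivative bump_fun p' j' x) (at x)"
proof -
  define q :: "real poly" where "q = [:0, 1, -1:]"
  \<comment> \<open>Since the derivative of \<open>- 1 / q\<close> is \<open>q' / q\<^sup>2\<close>,
    differentiation gives terms over \<open>q ^ j\<close>, \<open>q ^ (j + 1)\<close> and
    \<open>q ^ (j + 2)\<close>; \<open>p'\<close> is their numerator over the common denominator
    \<open>q ^ (j + 2)\<close>.\<close>
  define p' where "p' = pderiv p * q\<^sup>2 - smult (real j) (p * pderiv q * q) + p * pderiv q"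
  have pq: "poly q x = x * (1 - x)" for x
    by (simp add: q_def algebra_simps)
  have "(bump_fun p j has_real_derivative bump_fun p' (j + 2) x) (at x)" for x
  proof -
    consider "x < 0" | "x = 0" | "0 < x" "x < 1" | "x = 1" | "1 < x" by linarith
    then show ?thesis
    proof cases
      case 1
      have "((\<lambda>_. 0) has_real_derivative 0) (at x)" by simp
      then have "(bump_fun p j has_real_derivative 0) (at x)"
        by (rule has_field_derivative_transform_within_open[of _ _ _ "{..<0}"])
           (use 1 in \<open>auto simp: bump_fun_def\<close>)
      then show ?thesis using 1 by (simp add: bump_fun_def)
    next
      case 5
      have "((\<lambda>_. 0) has_real_derivative 0) (at x)" by simp
      then have "(bump_fun p j has_real_derivative 0) (at x)"
        by (rule has_field_derivative_transform_within_open[of _ _ _ "{1<..}"])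
           (use 5 in \<open>auto simp: bump_fun_def\<close>)
      then show ?thesis using 5 by (simp add: bump_fun_def)
    next
      case 2
      obtain C where "\<And>y. \<bar>bump_fun p j y\<bar> \<le> C * y\<^sup>2"
        using bump_fun_bound by blast
      then have "(bump_fun p j has_real_derivative 0) (at x)"
        using 2 by (intro has_derivative_0_of_quadratic_bound[where C = C]) simp
      then show ?thesis using 2 by (simp add: bump_fun_def)
    next
      case 4
      obtain C where "\<And>y. \<bar>bump_fun p j y\<bar> \<le> C * (y - 1)\<^sup>2"
        using bump_fun_bound by blast
      then have "(bump_fun p j has_real_derivative 0) (at x)"
        using 4 by (intro has_derivative_0_of_quadratic_bound[where C = C]) simp
      then show ?thesis using 4 by (simp add: bump_fun_def)
    next
      case 3
      then have q0: "poly q x \<noteq> 0" by (simp add: pq)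
      have "((\<lambda>x. poly p x / poly q x ^ j * exp (- 1 / poly q x)) has_real_derivative
          (poly (pderiv p) x / poly q x ^ j
            - real j * poly p x * poly (pderiv q) x / poly q x ^ (j + 1)
            + poly p x * poly (pderiv q) x / poly q x ^ (j + 2)) * exp (- 1 / poly q x)) (at x)"
        \<comment> \<open>The split on \<open>j\<close> deals with the exponent \<open>j - 1\<close>
          of the power rule, which is truncated at \<open>j = 0\<close>.\<close>
        by (cases j) (rule derivative_eq_intros poly_DERIV refl
            | simp add: q0 divide_simps | simp add: power2_eq_square algebra_simps q0)+
      also have "(poly (pderiv p) x / poly q x ^ j
            - real j * poly p x * poly (pderiv q) x / poly q x ^ (j + 1)
            + poly p x * poly (pderiv q) x / poly q x ^ (j + 2)) * exp (- 1 / poly q x)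
          = bump_fun p' (j + 2) x"
        using 3 q0 unfolding bump_fun_def pq[symmetric] p'_def
        by (simp add: divide_simps power_add power2_eq_square) (simp add: algebra_simps)
      finally show ?thesis
        by (rule has_field_derivative_transform_within_open[of _ _ _ "{0<..<1}"])
           (use 3 in \<open>auto simp: bump_fun_def pq\<close>)
    qed
  qed
  then show ?thesis by blast
qed

lemma funpow_deriv_bump_fun: "\<exists>p' j'. (deriv ^^ k) (bump_fun p j) = bump_fun p' j'"
proof (induction k)
  case (Suc k)
  then obtain p1 j1 where 1: "(deriv ^^ k) (bump_fun p j) = bump_fun p1 j1" by blast
  obtain p2 j2 where "\<And>x. (bump_fun p1 j1 has_real_derivative bump_fun p2 j2 x) (at x)"
    using bump_fun_has_derivative by blast
  then have "deriv (bump_fun p1 j1) = bump_fun p2 j2"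
    by (intro ext DERIV_imp_deriv)
  then show ?case using 1 by auto
qed auto

lemma funpow_deriv_bump_fun_differentiable:
  "(deriv ^^ k) (bump_fun p j) differentiable (at x)"
  using funpow_deriv_bump_fun[of k p j] bump_fun_has_derivative
  by (metis real_differentiable_def)

lemma continuous_on_bump_fun: "continuous_on S (bump_fun p j)"
  using bump_fun_has_derivative[of p j]
  by (meson DERIV_isCont continuous_at_imp_continuous_on)

lemma integral_bump_fun_pos: "integral {0..1} (bump_fun 1 0) > 0"
proof -
  have nn: "bump_fun 1 0 x \<ge> 0" for x
    by (simp add: bump_fun_def)
  have "integral {0..1} (bump_fun 1 0) \<noteq> 0"
  proof
    assume "integral {0..1} (bump_fun 1 0) = 0"
    then have "bump_fun 1 0 (1/2) = 0"
      by (subst (asm) integral_eq_0_iff) (auto simp: nn continuous_on_bump_fun)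
    then show False by (simp add: bump_fun_def)
  qed
  moreover have "integral {0..1} (bump_fun 1 0) \<ge> 0"
    by (rule integral_nonneg) (auto simp: nn intro!: integrable_continuous_interval continuous_on_bump_fun)
  ultimately show ?thesis by linarith
qed

lemma smooth_step_exists:
  obtains \<theta> :: "real \<Rightarrow> real" and C
  where "\<And>x. (\<theta> has_real_derivative bump_fun p j x) (at x)" "\<And>x. x \<le> 0 \<Longrightarrow> \<theta> x = 0" "\<And>x. x \<ge> 1 \<Longrightarrow> \<theta> x = C"
proof -
  \<comment> \<open>Starting at -1 instead of 0 makes 0 an inner point of the interval of
    integration, so that the fundamental theorem yields a two-sided derivative there. Below -1 the
    interval is empty and the integral is 0, as wanted.\<close>
  define \<theta> where "\<theta> = (\<lambda>x. integral {-1..x} (bump_fun p j))"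
  have \<theta>0: "\<theta> x = 0" if "x \<le> 0" for x
    using that unfolding \<theta>_def
    by (subst integral_cong[where g = "\<lambda>_. 0"]) (auto simp: bump_fun_def)
  have "\<theta> x = \<theta> 1" if "x \<ge> 1" for x
  proof -
    have "\<theta> x = integral {-1..1} (bump_fun p j) + integral {1..x} (bump_fun p j)"
      unfolding \<theta>_def using that
      by (intro Henstock_Kurzweil_Integration.integral_combine[symmetric]
          integrable_continuous_interval continuous_on_bump_fun) auto
    also have "integral {1..x} (bump_fun p j) = integral {1..x} (\<lambda>_. 0)"
      by (intro integral_cong) (auto simp: bump_fun_def)
    finally show ?thesis by (simp add: \<theta>_def)
  qed
  moreover have "(\<theta> has_real_derivative bump_fun p j x) (at x)" for x
  proof (cases "x < 0")
    case True
    have "((\<lambda>_. 0) has_real_derivative 0) (at x)" by simp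
    then have "(\<theta> has_real_derivative 0) (at x)"
      by (rule has_field_derivative_transform_within_open[of _ _ _ "{..<0}"])
         (use True \<theta>0 in auto)
    then show ?thesis using True by (simp add: bump_fun_def)
  next
    case False
    have "(\<theta> has_real_derivative bump_fun p j x) (at x within {-1..x+1})"
      unfolding \<theta>_def using False
      by (intro integral_has_real_derivative continuous_on_bump_fun) auto
    moreover have "at x within {-1..x+1} = at x"
      using False by (intro at_within_Icc_at) auto
    ultimately show ?thesis by simp
  qed
  ultimately show ?thesis using that \<theta>0 by blast
qed

lemma scaled_diff_has_derivative:
  fixes f f' :: "real \<Rightarrow> real"
  assumes "\<And>x. (f has_real_derivative f' x) (at x)"
  shows "((\<lambda>x. r * (f ((x - c) / e) - f ((x - d) / e))) has_real_derivative
           r / e * (f' ((x - c) / e) - f' ((x - d) / e))) (at x)"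
proof -
  have *: "((\<lambda>x. f ((x - z) / e)) has_real_derivative f' ((x - z) / e) * (1 / e)) (at x)" for z
    by (rule DERIV_chain2[OF assms]) (auto intro!: derivative_eq_intros simp: divide_inverse)
  show ?thesis
    using DERIV_cmult[OF DERIV_diff[OF *[of c] *[of d]], of r]
    by (simp add: algebra_simps divide_inverse)
qed

lemma scaled_diff_differentiable:
  fixes B :: "real \<Rightarrow> real"
  assumes "\<And>k x. (deriv ^^ k) B differentiable (at x)"
  shows "(deriv ^^ k) (\<lambda>x. r * (B ((x - c) / e) - B ((x - d) / e))) differentiable (at x)"
proof -
  \<comment> \<open>This is the k-th derivative in closed form: every differentiation contributes a
    factor \<open>1 / e\<close>.\<close>
  let ?f = "\<lambda>k x. r / e ^ k * ((deriv ^^ k) B ((x - c) / e) - (deriv ^^ k) B ((x - d) / e))"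
  have "((deriv ^^ k) B has_real_derivative (deriv ^^ Suc k) B x) (at x)" for k x
    using assms[of k x] DERIV_imp_deriv by (force simp: real_differentiable_def)
  then have D: "(?f k has_real_derivative ?f (Suc k) x) (at x)" for k x
    using scaled_diff_has_derivative[of "(deriv ^^ k) B" "(deriv ^^ Suc k) B" "r / e ^ k" c e d x]
    by (simp add: mult.commute del: funpow.simps)
  have "(deriv ^^ k) (?f 0) = ?f k"
  proof (induction k)
    case (Suc k)
    then show ?case using DERIV_imp_deriv[OF D] by auto
  qed simp
  then show ?thesis
    using D[of k x] unfolding real_differentiable_def by auto
qed

section \<open>Test functions and the du Bois-Reymond lemma\<close>

lemma test_fun_has_derivative:
  assumes "test_fun a b \<phi>"
  shows "(\<phi> has_real_derivative deriv \<phi> x) (at x)"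
  using assms DERIV_imp_deriv unfolding test_fun_def real_differentiable_def
  by (metis funpow_0)

lemma test_fun_deriv:
  assumes "test_fun a b \<phi>"
  shows "test_fun a b (deriv \<phi>)"
proof -
  obtain c d where cd: "a < c" "d < b" "\<And>x. x \<notin> {c..d} \<Longrightarrow> \<phi> x = 0"
    using assms unfolding test_fun_def by blast
  have "deriv \<phi> x = 0" if "x \<notin> {c..d}" for x
  proof (rule DERIV_imp_deriv)
    have "((\<lambda>_. 0) has_real_derivative 0) (at x)" by simp
    then show "(\<phi> has_real_derivative 0) (at x)"
      by (rule has_field_derivative_transform_within_open[of _ _ _ "- {c..d}"])
         (use that cd(3) in auto)
  qed
  moreover have "(deriv ^^ k) (deriv \<phi>) differentiable (at x)" for k x
    using assms unfolding test_fun_def by (metis funpow_Suc_right comp_apply)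
  ultimately show ?thesis
    using cd unfolding test_fun_def by blast
qed

lemma continuous_on_test_fun:
  assumes "test_fun a b \<phi>"
  shows "continuous_on S \<phi>"
  using test_fun_has_derivative[OF assms]
  by (meson DERIV_isCont continuous_at_imp_continuous_on)

lemma test_fun_eq_0:
  assumes "test_fun a b \<phi>" "x \<le> a \<or> b \<le> x"
  shows "\<phi> x = 0"
  using assms unfolding test_fun_def by force

text \<open>The test function is a difference of two translates of a smooth step, so its derivative is
  a difference of two bumps; letting their width tend to \<open>0\<close> compares the values of \<open>G\<close>.\<close>

lemma du_Bois_Reymond_interior:
  assumes G: "continuous_on {a..b} G"
    and orth: "\<And>\<phi>. test_fun a b \<phi> \<Longrightarrow> integral {a..b} (\<lambda>x. G x * deriv \<phi> x) = 0"
    and "a < c" "c < d" "d < b"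
  shows "G c = G d"
proof -
  let ?B = "bump_fun 1 0"
  obtain \<theta> C where \<theta>: "\<And>x. (\<theta> has_real_derivative ?B x) (at x)"
    "\<And>x. x \<le> 0 \<Longrightarrow> \<theta> x = 0" "\<And>x. x \<ge> 1 \<Longrightarrow> \<theta> x = C"
    using smooth_step_exists[of 1 0] by metis
  have "(deriv ^^ k) \<theta> differentiable (at x)" for k x
  proof (cases k)
    case 0
    then show ?thesis using \<theta>(1) by (auto simp: real_differentiable_def)
  next
    case (Suc l)
    have "deriv \<theta> = ?B" using \<theta>(1) by (intro ext DERIV_imp_deriv)
    then show ?thesis
      using funpow_deriv_bump_fun_differentiable[of l 1 0 x]
      by (simp add: Suc funpow_swap1 del: funpow.simps) (simp add: funpow_Suc_right del: funpow.simps)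
  qed
  note \<theta>_smooth = this
  \<comment> \<open>Substitute \<open>x = z + e * u\<close>. The rescaled bump vanishes outside
    \<open>{z..z+e}\<close>, so the integral over \<open>{a..b}\<close> is an average of
    \<open>G\<close> over this short interval, up to the factor \<open>e\<close>.\<close>
  have shift: "((\<lambda>x. G x * ?B ((x - z) / e)) has_integral e * integral {0..1} (\<lambda>u. G (z + e * u) * ?B u)) {a..b}"
    if z: "a \<le> z" "z + e \<le> b" and e: "e > 0" for z e
  proof -
    have "continuous_on {0..1} (\<lambda>u. G (z + e * u))"
      by (rule continuous_on_compose2[OF G]) (use z e in \<open>auto intro!: continuous_intros add_increasing2\<close>,
          smt (verit, best) mult_left_le)
    then have "((\<lambda>u. G (z + e * u) * ?B u) has_integral integral {0..1} (\<lambda>u. G (z + e * u) * ?B u)) (cbox 0 1)"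
      by (auto intro!: integrable_integral integrable_continuous_interval continuous_intros continuous_on_bump_fun)
    from has_integral_affinity[OF this, of "1/e" "- z / e"] e
    have "((\<lambda>x. G (z + e * (x / e - z / e)) * ?B (x / e - z / e)) has_integral
        e * integral {0..1} (\<lambda>u. G (z + e * u) * ?B u)) ((\<lambda>x. e * x + z) ` {0..1})"
      by (simp add: algebra_simps)
    moreover have "(\<lambda>x. e * x + z) ` {0..1} = {z..z+e}"
      using e by (subst image_affinity_atLeastAtMost) (auto simp: add.commute)
    ultimately have "((\<lambda>x. G x * ?B ((x - z) / e)) has_integral
        e * integral {0..1} (\<lambda>u. G (z + e * u) * ?B u)) {z..z+e}"
      using e by (simp add: diff_divide_distrib right_diff_distrib)
    then show ?thesis
      by (rule has_integral_on_superset) (use z e in \<open>auto simp: bump_fun_def field_simps\<close>)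
  qed
  have eq: "integral {0..1} (\<lambda>u. G (c + e * u) * ?B u) = integral {0..1} (\<lambda>u. G (d + e * u) * ?B u)"
    if e: "e > 0" "e < b - d" for e
  proof -
    \<comment> \<open>To the left of \<open>c\<close> both steps are 0, and to the right of
      \<open>d + e\<close> both equal \<open>C\<close> and cancel. This gives the compact support,
      and \<open>e < b - d\<close> keeps it inside the open interval.\<close>
    define \<phi> where "\<phi> = (\<lambda>x. 1 * (\<theta> ((x - c) / e) - \<theta> ((x - d) / e)))"
    have "\<phi> x = 0" if "x \<notin> {c..d+e}" for x
    proof (cases "x < c")
      case True
      then show ?thesis using assms e by (simp add: \<phi>_def \<theta>(2) field_simps)
    next
      case False
      then show ?thesis using assms e that by (simp add: \<phi>_def \<theta>(3) field_simps)
    qed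
    then have "test_fun a b \<phi>"
      using scaled_diff_differentiable[OF \<theta>_smooth, of _ 1 c e d] assms e
      unfolding test_fun_def \<phi>_def
      by (intro conjI allI exI[of _ c] exI[of _ "d + e"]) auto
    from orth[OF this] have 0: "integral {a..b} (\<lambda>x. G x * deriv \<phi> x) = 0" .
    have "deriv \<phi> x = (?B ((x - c) / e) - ?B ((x - d) / e)) / e" for x
    proof (rule DERIV_imp_deriv)
      show "(\<phi> has_real_derivative (?B ((x - c) / e) - ?B ((x - d) / e)) / e) (at x)"
        using scaled_diff_has_derivative[OF \<theta>(1), of 1 c e d x] by (simp add: \<phi>_def)
    qed
    then have "(\<lambda>x. G x * deriv \<phi> x) = (\<lambda>x. (G x * ?B ((x - c) / e) - G x * ?B ((x - d) / e)) / e)"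
      by (simp add: diff_divide_distrib right_diff_distrib)
    moreover have "((\<lambda>x. (G x * ?B ((x - c) / e) - G x * ?B ((x - d) / e)) / e) has_integral
       (e * integral {0..1} (\<lambda>u. G (c + e * u) * ?B u) - e * integral {0..1} (\<lambda>u. G (d + e * u) * ?B u)) / e) {a..b}"
      using assms e by (intro has_integral_divide has_integral_diff shift) auto
    ultimately have "((\<lambda>x. G x * deriv \<phi> x) has_integral
       (e * integral {0..1} (\<lambda>u. G (c + e * u) * ?B u) - e * integral {0..1} (\<lambda>u. G (d + e * u) * ?B u)) / e) {a..b}"
      by (simp only:)
    from integral_unique[OF this] 0
    have "(e * integral {0..1} (\<lambda>u. G (c + e * u) * ?B u) - e * integral {0..1} (\<lambda>u. G (d + e * u) * ?B u)) / e = 0"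
      by (simp only:)
    then show ?thesis using e by simp
  qed
  define I where "I = (\<lambda>z e. integral {0..1} (\<lambda>u. G (z + e * u) * ?B u))"
  define e0 where "e0 = (b - d) / 2"
  have e0: "e0 > 0" "d + e0 < b" using assms by (auto simp: e0_def field_simps)
  have contI: "continuous_on {0..e0} (I z)" if "a < z" "z \<le> d" for z
  proof -
    have "continuous_on ({0..e0} \<times> {0..1}) (\<lambda>x. G (z + fst x * snd x))"
    proof (rule continuous_on_compose2[OF G])
      have "z + e * u \<le> b" if "e \<in> {0..e0}" "u \<in> {0..1}" for e u
      proof -
        have "e * u \<le> e0 * 1" using that by (intro mult_mono) auto
        then show ?thesis using \<open>z \<le> d\<close> e0 by linarith
      qed
      moreover have "a \<le> z + e * u" if "e \<in> {0..e0}" "u \<in> {0..1}" for e u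
        using that \<open>a < z\<close> by (simp add: add_increasing2)
      ultimately show "(\<lambda>x. z + fst x * snd x) ` ({0..e0} \<times> {0..1}) \<subseteq> {a..b}"
        by auto
    qed (intro continuous_intros)
    then have "continuous_on ({0..e0} \<times> cbox 0 1) (\<lambda>(e, u). G (z + e * u) * ?B u)"
      unfolding case_prod_beta
      by (auto intro!: continuous_intros continuous_on_compose2[OF continuous_on_bump_fun[of UNIV]])
    from integral_continuous_on_param[OF this] show ?thesis
      by (simp add: I_def)
  qed
  \<comment> \<open>The averages agree for small \<open>e > 0\<close>, hence by continuity also at
    \<open>e = 0\<close>, where \<open>I z 0\<close> is \<open>G z\<close> times the positive
    integral of the bump.\<close>
  have "I c 0 - I d 0 = 0"
  proof (rule continuous_constant_on_closure[of "{0<..<e0}" "\<lambda>e. I c e - I d e"])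
    show "continuous_on (closure {0<..<e0}) (\<lambda>e. I c e - I d e)"
      using e0 assms contI by (auto intro!: continuous_intros)
    show "I c e - I d e = 0" if "e \<in> {0<..<e0}" for e
      using eq[of e] that e0 by (simp add: I_def)
  qed (use e0 in auto)
  then have "(G c - G d) * integral {0..1} ?B = 0"
    by (simp add: I_def left_diff_distrib)
  then show ?thesis using integral_bump_fun_pos by simp
qed

lemma du_Bois_Reymond:
  assumes G: "continuous_on {a..b} G"
    and orth: "\<And>\<phi>. test_fun a b \<phi> \<Longrightarrow> integral {a..b} (\<lambda>x. G x * deriv \<phi> x) = 0"
    and "a < b" "x \<in> {a..b}" 
  shows "G x = G a"
proof -
  define c where "c = (a + b) / 2"
  have c: "a < c" "c < b" using assms by (auto simp: c_def)
  have *: "G y = G c" if "y \<in> {a<..<b}" for y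
    using du_Bois_Reymond_interior[OF G orth, of c y] du_Bois_Reymond_interior[OF G orth, of y c] that c
    by (cases y c rule: linorder_cases) auto
  have "G y = G c" if "y \<in> {a..b}" for y
    by (rule continuous_constant_on_closure[of "{a<..<b}" G]) (use assms * that in auto)
  with assms show ?thesis by simp
qed

subsection \<open>Riemann--Liouville integrals of functions\<close>

lemma absolutely_integrable_AE:
  fixes f g :: "'a::euclidean_space \<Rightarrow> 'b::euclidean_space"
  assumes ae: "AE x in lborel. x \<in> S \<longrightarrow> f x = g x" and f: "f absolutely_integrable_on S"
  shows "g absolutely_integrable_on S"
proof -
  have "AE x in lborel. x \<in> S \<longrightarrow> norm (f x) = norm (g x)"
    using ae by eventually_elim auto
  then show ?thesis
    using f has_integral_AE[OF ae] has_integral_AE[of S "\<lambda>x. norm (f x)" "\<lambda>x. norm (g x)"]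
    unfolding absolutely_integrable_on_def integrable_on_def by auto
qed

lemma integral_AE:
  fixes f g :: "'a::euclidean_space \<Rightarrow> 'b::euclidean_space"
  assumes "AE x in lborel. x \<in> S \<longrightarrow> f x = g x"
  shows "integral S f = integral S g"
  unfolding integral_def integrable_on_def has_integral_AE[OF assms] ..

text \<open>The bridge between the two integrals in use: Fubini's theorem is applied to Bochner
  integrals over \<open>lborel\<close>, whereas the definitions are stated with the gauge integral
  over a set.\<close>

lemma lborel_integrable_supported:
  fixes f :: "'a::euclidean_space \<Rightarrow> real"
  assumes f: "integrable lborel f" and "\<And>x. x \<notin> S \<Longrightarrow> f x = 0"
  shows "f absolutely_integrable_on S" "integral S f = integral\<^sup>L lborel f"
proof -
  have eq: "(\<lambda>x. if x \<in> S then f x else 0) = f" "(\<lambda>x. indicator S x * f x) = f"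
    by (auto simp: fun_eq_iff assms(2) split: split_indicator)
  have "integrable lebesgue f"
    using f by (simp add: integrable_completion)
  then show "f absolutely_integrable_on S"
    by (simp add: set_integrable_def eq)
  show "integral S f = integral\<^sup>L lborel f"
    using integral_restrict_UNIV[of S f] integral_lborel[OF f] by (simp add: eq)
qed

text \<open>Both sides integrate \<open>K s t * g t\<close> over
  \<open>a \<le> t \<le> s \<le> y\<close>. The uniform bound \<open>C\<close> on the integrals of
  \<open>\<bar>K s t\<bar>\<close> in \<open>s\<close> makes the integrand integrable on the
  product, so the order may be exchanged.\<close>

lemma triangle_Fubini:
  fixes K :: "real \<Rightarrow> real \<Rightarrow> real"
  assumes K [measurable]: "(\<lambda>(t, s). K s t) \<in> borel_measurable (lborel \<Otimes>\<^sub>M lborel)"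
    and g: "g absolutely_integrable_on {a..y}"
    and Kint: "\<And>t. t \<in> {a..y} \<Longrightarrow> (\<lambda>s. K s t) absolutely_integrable_on {t..y}"
    and Kbd: "\<And>t. t \<in> {a..y} \<Longrightarrow> integral {t..y} (\<lambda>s. \<bar>K s t\<bar>) \<le> C"
  shows "(\<lambda>s. integral {a..s} (\<lambda>t. K s t * g t)) absolutely_integrable_on {a..y}" (is ?int)
    and "integral {a..y} (\<lambda>s. integral {a..s} (\<lambda>t. K s t * g t))
       = integral {a..y} (\<lambda>t. integral {t..y} (\<lambda>s. K s t) * g t)" (is ?eq)
proof -
  \<comment> \<open>The function \<open>g\<close> is only Lebesgue measurable, while measurability
    on the product of the Borel measures is required. Hence \<open>g\<close> is replaced by a Borel
    function \<open>g1\<close> that equals it almost everywhere on \<open>{a..y}\<close> and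
    vanishes outside.\<close>
  define g0 where "g0 = (\<lambda>t. indicator {a..y} t * g t)"
  have g0: "integrable lebesgue g0"
    using g by (simp add: set_integrable_def g0_def)
  then obtain g' where g'[measurable]: "g' \<in> borel_measurable lborel" and ae': "AE t in lborel. g0 t = g' t"
    using completion_ex_borel_measurable_real[of g0 lborel] by (auto simp: borel_measurable_integrable)
  define g1 where "g1 = (\<lambda>t. indicator {a..y} t * g' t)"
  have [measurable]: "g1 \<in> borel_measurable lborel" unfolding g1_def by measurable
  have ae: "AE t in lborel. g0 t = g1 t"
    using ae' by eventually_elim (auto simp: g0_def g1_def split: split_indicator)
  have "integrable lebesgue g1"
    using g0 by (rule Bochner_Integration.integrable_cong_AE_imp)
       (use ae in \<open>auto intro!: measurable_completion AE_completion simp: eq_commute\<close>)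
  then have g1: "integrable lborel g1"
    by (simp add: integrable_completion)
  have g1_out: "g1 t = 0" if "t \<notin> {a..y}" for t
    using that by (simp add: g1_def)
  have g1_eq: "AE t in lborel. t \<in> {a..y} \<longrightarrow> g1 t = g t"
    using ae by eventually_elim (auto simp: g0_def)

  \<comment> \<open>The integrand extended by 0 to the plane; the condition \<open>a \<le> t\<close>
    is enforced by the support of \<open>g1\<close>.\<close>
  define f where "f = (\<lambda>t s. if t \<le> s \<and> s \<le> y then K s t * g1 t else 0)"
  have f_meas [measurable]: "case_prod f \<in> borel_measurable (lborel \<Otimes>\<^sub>M lborel)"
  proof -
    have "(\<lambda>x. if fst x \<le> snd x \<and> snd x \<le> y then (\<lambda>(t, s). K s t) x * g1 (fst x) else 0)
        \<in> borel_measurable (lborel \<Otimes>\<^sub>M lborel)"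
      by measurable
    then show ?thesis by (simp add: f_def case_prod_beta')
  qed
  have K_meas: "(\<lambda>s. K s t) \<in> borel_measurable lborel" for t
    using measurable_Pair2[OF K, of t] by simp
  have f_t: "integrable lborel (f t) \<and> integral\<^sup>L lborel (f t) = integral {t..y} (\<lambda>s. K s t) * g1 t
      \<and> (\<integral>s. norm (f t s) \<partial>lborel) = integral {t..y} (\<lambda>s. \<bar>K s t\<bar>) * \<bar>g1 t\<bar>" for t
  proof (cases "t \<in> {a..y}")
    case True
    let ?k = "\<lambda>s. indicator {t..y} s * K s t"
    have "integrable lebesgue ?k"
      using Kint[OF True] by (simp add: set_integrable_def)
    moreover have "?k \<in> borel_measurable lborel"
      using K_meas by measurable
    ultimately have k: "integrable lborel ?k"
      by (simp add: integrable_completion)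
    have feq: "f t = (\<lambda>s. ?k s * g1 t)"
      by (auto simp: f_def indicator_def)
    have "integral\<^sup>L lborel ?k = integral {t..y} ?k"
      by (rule lborel_integrable_supported(2)[symmetric]) (use k in auto)
    also have "\<dots> = integral {t..y} (\<lambda>s. K s t)"
      by (intro integral_cong) auto
    finally have 1: "integral\<^sup>L lborel ?k = integral {t..y} (\<lambda>s. K s t)" .
    have "integral\<^sup>L lborel (\<lambda>s. \<bar>?k s\<bar>) = integral {t..y} (\<lambda>s. \<bar>?k s\<bar>)"
      by (rule lborel_integrable_supported(2)[symmetric]) (use k in auto)
    also have "\<dots> = integral {t..y} (\<lambda>s. \<bar>K s t\<bar>)"
      by (intro integral_cong) auto
    finally have 2: "integral\<^sup>L lborel (\<lambda>s. \<bar>?k s\<bar>) = integral {t..y} (\<lambda>s. \<bar>K s t\<bar>)" .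
    show ?thesis
      using k 1 2 by (simp add: feq abs_mult[of _ "g1 t"])
  next
    case False
    then have "f t = (\<lambda>_. 0)" by (auto simp: f_def g1_out)
    then show ?thesis using False by (simp add: g1_out)
  qed

  have f_int: "integrable (lborel \<Otimes>\<^sub>M lborel) (case_prod f)"
  proof (rule lborel_pair.Fubini_integrable)
    show "integrable lborel (\<lambda>t. \<integral>s. norm (case_prod f (t, s)) \<partial>lborel)"
    proof (rule Bochner_Integration.integrable_bound)
      show "integrable lborel (\<lambda>t. C * g1 t)" using g1 by simp
      show "(\<lambda>t. \<integral>s. norm (case_prod f (t, s)) \<partial>lborel) \<in> borel_measurable lborel"
        by measurable
      have "norm (\<integral>s. norm (f t s) \<partial>lborel) \<le> norm (C * g1 t)" for t
      proof (cases "t \<in> {a..y}")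
        case True
        have "0 \<le> integral {t..y} (\<lambda>s. \<bar>K s t\<bar>)"
          using Kint[OF True] by (intro integral_nonneg) (auto simp: absolutely_integrable_on_def)
        then show ?thesis
          using f_t[of t] Kbd[OF True] by (auto simp: abs_mult intro!: mult_right_mono)
      qed (use f_t[of t] g1_out in auto)
      then show "AE t in lborel. norm (\<integral>s. norm (case_prod f (t, s)) \<partial>lborel) \<le> norm (C * g1 t)"
        by simp
    qed
  qed (use f_t in \<open>auto simp: f_meas\<close>)

  define h where "h = (\<lambda>s. \<integral>t. f t s \<partial>lborel)"
  have h_int: "integrable lborel h"
    unfolding h_def by (rule lborel_pair.integrable_snd[OF f_int])
  have h_out: "h s = 0" if "s \<notin> {a..y}" for s
  proof -
    have "f t s = 0" for t
      using that by (auto simp: f_def g1_out)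
    then show ?thesis by (simp add: h_def)
  qed
  \<comment> \<open>Sections of an integrable function are integrable only almost everywhere, so
    this identity holds for almost all \<open>s\<close>. That suffices for integrability and for the
    value of the outer integral.\<close>
  have h_eq: "AE s in lborel. s \<in> {a..y} \<longrightarrow> h s = integral {a..s} (\<lambda>t. K s t * g t)"
    using lborel_pair.AE_integrable_snd[OF f_int]
  proof eventually_elim
    case (elim s)
    show ?case
    proof
      assume s: "s \<in> {a..y}"
      have "h s = integral {a..s} (\<lambda>t. f t s)"
        unfolding h_def
        by (rule lborel_integrable_supported(2)[symmetric, OF elim]) (use s in \<open>auto simp: f_def g1_out\<close>)
      also have "\<dots> = integral {a..s} (\<lambda>t. K s t * g t)"
        by (rule integral_AE) (use g1_eq s in \<open>eventually_elim, auto simp: f_def\<close>)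
      finally show "h s = integral {a..s} (\<lambda>t. K s t * g t)" .
    qed
  qed
  have h_supp: "h absolutely_integrable_on {a..y}" "integral {a..y} h = integral\<^sup>L lborel h"
    using lborel_integrable_supported[OF h_int, of "{a..y}"] h_out by blast+
  show ?int
    by (rule absolutely_integrable_AE[OF h_eq h_supp(1)])
  have "integral {a..y} (\<lambda>s. integral {a..s} (\<lambda>t. K s t * g t)) = integral\<^sup>L lborel h"
    using integral_AE[OF h_eq] h_supp(2) by (simp only:)
  also have "\<dots> = (\<integral>t. integral\<^sup>L lborel (f t) \<partial>lborel)"
    unfolding h_def by (rule lborel_pair.Fubini_integral[OF f_int])
  also have "\<dots> = integral {a..y} (\<lambda>t. integral\<^sup>L lborel (f t))"
    by (rule lborel_integrable_supported(2)[symmetric, OF lborel_pair.integrable_fst[OF f_int]])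
       (simp add: f_t g1_out)
  also have "\<dots> = integral {a..y} (\<lambda>t. integral {t..y} (\<lambda>s. K s t) * g t)"
    by (rule integral_AE) (use g1_eq in \<open>eventually_elim, auto simp: f_t\<close>)
  finally show ?eq .
qed

text \<open>The indefinite integral of \<open>g\<close> need not be differentiable everywhere, so
  the product rule is avoided: exchange the integrals with the kernel
  \<open>K s t = \<phi>' s\<close>; the inner integral then becomes
  \<open>\<phi> b - \<phi> t = - \<phi> t\<close>.\<close>

lemma indefinite_integral_by_parts:
  fixes g \<phi> \<phi>' :: "real \<Rightarrow> real"
  assumes g: "g absolutely_integrable_on {a..b}"
    and \<phi>: "\<And>x. (\<phi> has_real_derivative \<phi>' x) (at x)"
    and \<phi>': "continuous_on UNIV \<phi>'" and "\<phi> b = 0"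
  shows "integral {a..b} (\<lambda>s. integral {a..s} g * \<phi>' s) = - integral {a..b} (\<lambda>t. g t * \<phi> t)"
proof -
  have cont: "continuous_on S \<phi>'" for S
    using \<phi>' continuous_on_subset by blast
  have "bounded (\<phi>' ` {a..b})"
    by (intro compact_imp_bounded compact_continuous_image cont) auto
  then obtain M where M: "M > 0" "\<And>x. x \<in> {a..b} \<Longrightarrow> \<bar>\<phi>' x\<bar> \<le> M"
    unfolding bounded_pos by auto
  have m: "(\<lambda>(t::real, s). \<phi>' s) \<in> borel_measurable (lborel \<Otimes>\<^sub>M lborel)"
    using borel_measurable_continuous_onI[OF \<phi>'] by (simp add: case_prod_beta')
  have "integral {a..b} (\<lambda>s. integral {a..s} (\<lambda>t. \<phi>' s * g t)) = integral {a..b} (\<lambda>t. integral {t..b} \<phi>' * g t)"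
  proof (rule triangle_Fubini(2)[OF m g])
    fix t assume t: "t \<in> {a..b}"
    show "\<phi>' absolutely_integrable_on {t..b}"
      by (intro absolutely_integrable_continuous_real cont)
    have "integral {t..b} (\<lambda>s. \<bar>\<phi>' s\<bar>) \<le> integral {t..b} (\<lambda>s. M)"
      using t M by (intro integral_le integrable_continuous_interval continuous_intros cont) auto
    also have "\<dots> \<le> M * (b - a)"
      using t M by (simp add: mult.commute)
    finally show "integral {t..b} (\<lambda>s. \<bar>\<phi>' s\<bar>) \<le> M * (b - a)" .
  qed
  also have "\<dots> = integral {a..b} (\<lambda>t. - (g t * \<phi> t))"
  proof (rule integral_cong)
    fix t assume t: "t \<in> {a..b}"
    have "(\<phi>' has_integral \<phi> b - \<phi> t) {t..b}"
      using t \<phi> by (intro fundamental_theorem_of_calculus)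
        (auto simp: has_real_derivative_iff_has_vector_derivative[symmetric] has_field_derivative_at_within)
    then show "integral {t..b} \<phi>' * g t = - (g t * \<phi> t)"
      by (simp add: integral_unique assms)
  qed
  finally show ?thesis
    by (simp add: mult.commute)
qed

section \<open>The Beta integral and the semigroup law\<close>

lemma has_integral_Beta_shifted:
  fixes \<alpha> \<beta> t y :: real
  assumes "\<alpha> > 0" "\<beta> > 0" "t \<le> y"
  shows "((\<lambda>s. (y - s) powr (\<alpha> - 1) * (s - t) powr (\<beta> - 1)) has_integral
           Beta \<alpha> \<beta> * (y - t) powr (\<alpha> + \<beta> - 1)) {t..y}"
\<comment> \<open>For \<open>t = y\<close> the right-hand side is 0 even if
  \<open>\<alpha> + \<beta> = 1\<close>, by the convention \<open>0 powr 0 = 0\<close>.\<close>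
proof (cases "t = y")
  case True
  then show ?thesis using has_integral_refl(1) by simp
next
  case False
  define l where "l = y - t"
  have l: "l > 0" using False assms by (simp add: l_def)
  have "((\<lambda>u. u powr (\<beta> - 1) * (1 - u) powr (\<alpha> - 1)) has_integral Beta \<beta> \<alpha>) (cbox 0 1)"
    using has_integral_Beta_real[of \<beta> \<alpha>] assms by simp
  from has_integral_affinity'[OF this, of "1 / l" "- t / l"] l
  have "((\<lambda>s. (s / l - t / l) powr (\<beta> - 1) * (1 - (s / l - t / l)) powr (\<alpha> - 1)) has_integral
       Beta \<beta> \<alpha> * l) {t..t + l}"
    by (simp add: field_simps) (simp add: add_divide_distrib)
  \<comment> \<open>The unshifted integrand is homogeneous of degree
    \<open>\<alpha> + \<beta> - 2\<close> in lengths, so this power of \<open>l\<close> undoes the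
    normalisation of the interval to length 1.\<close>
  from has_integral_mult_left[OF this, of "l powr (\<alpha> + \<beta> - 2)"]
  have int: "((\<lambda>s. (s / l - t / l) powr (\<beta> - 1) * (1 - (s / l - t / l)) powr (\<alpha> - 1) * l powr (\<alpha> + \<beta> - 2))
       has_integral Beta \<beta> \<alpha> * l * l powr (\<alpha> + \<beta> - 2)) {t..t + l}" .
  have value_eq: "Beta \<beta> \<alpha> * l * l powr (\<alpha> + \<beta> - 2) = Beta \<alpha> \<beta> * (y - t) powr (\<alpha> + \<beta> - 1)"
    using l powr_mult_base[of l "\<alpha> + \<beta> - 2"] by (simp add: Beta_commute[of \<beta>] l_def)
  have integrand_eq: "(s / l - t / l) powr (\<beta> - 1) * (1 - (s / l - t / l)) powr (\<alpha> - 1) * l powr (\<alpha> + \<beta> - 2)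
      = (y - s) powr (\<alpha> - 1) * (s - t) powr (\<beta> - 1)" if "s \<in> {t..y}" for s
  proof -
    have ys: "y - s = l - (s - t)" by (simp add: l_def)
    have 1: "s / l - t / l = (s - t) / l" "1 - (s - t) / l = (y - s) / l"
      using l unfolding ys by (simp_all add: diff_divide_distrib)
    have 2: "l powr (\<alpha> + \<beta> - 2) = l powr (\<alpha> - 1) * l powr (\<beta> - 1)"
      by (simp flip: powr_add)
    show ?thesis
      unfolding 1 2 using that l by (simp add: powr_divide)
  qed
  have "t + l = y" by (simp add: l_def)
  from int[unfolded value_eq this] show ?thesis
    by (rule has_integral_eq[rotated]) (erule integrand_eq)
qed

text \<open>Exchanging the integrals leaves a Beta integral as the new kernel. The condition
  \<open>\<alpha> + \<beta> \<ge> 1\<close> bounds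
  \<open>(y - t) powr (\<alpha> + \<beta> - 1)\<close> uniformly in \<open>t\<close>, as Fubini
  requires here, so the law holds at the given point \<open>y\<close> and not merely almost
  everywhere.\<close>

lemma RL_L1fun_semigroup:
  fixes \<alpha> \<beta> y :: real
  assumes "\<alpha> > 0" "\<beta> > 0" "\<alpha> + \<beta> \<ge> 1" and g: "g absolutely_integrable_on {a..y}"
  shows "(\<lambda>s. (y - s) powr (\<alpha> - 1) * RL_L1fun a \<beta> g s) absolutely_integrable_on {a..y}"
    and "RL_L1fun a \<alpha> (RL_L1fun a \<beta> g) y = RL_L1fun a (\<alpha> + \<beta>) g y"
proof -
  let ?K = "\<lambda>s t. (y - s) powr (\<alpha> - 1) * (s - t) powr (\<beta> - 1)"
  have m: "(\<lambda>(t, s). ?K s t) \<in> borel_measurable (lborel \<Otimes>\<^sub>M lborel)"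
    by measurable
  note B = has_integral_Beta_shifted[OF assms(1,2)]
  have Beta: "Beta \<alpha> \<beta> = Gamma \<alpha> * Gamma \<beta> / Gamma (\<alpha> + \<beta>)"
    by (simp add: Beta_def)
  have Gpos: "Gamma \<alpha> > 0" "Gamma \<beta> > 0" "Gamma (\<alpha> + \<beta>) > 0"
    using assms by (auto intro!: Gamma_real_pos)
  have Bpos: "Beta \<alpha> \<beta> > 0" using Gpos by (simp add: Beta)
  have Kint: "(\<lambda>s. ?K s t) absolutely_integrable_on {t..y}" if "t \<in> {a..y}" for t
    using B[of t y] that by (intro nonnegative_absolutely_integrable_1) auto
  have Kbd: "integral {t..y} (\<lambda>s. \<bar>?K s t\<bar>) \<le> Beta \<alpha> \<beta> * (y - a) powr (\<alpha> + \<beta> - 1)" if "t \<in> {a..y}" for t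
    using B[of t y] that Bpos assms
    by (auto simp: abs_mult integral_unique intro!: mult_left_mono powr_mono2)
  note F = triangle_Fubini[OF m g Kint Kbd]
  have inner: "integral {a..s} (\<lambda>t. ?K s t * g t) = (y - s) powr (\<alpha> - 1) * RL_L1fun a \<beta> g s * Gamma \<beta>" for s
    using Gpos by (simp add: RL_L1fun_def mult.assoc)
  from F(1) have "(\<lambda>s. (y - s) powr (\<alpha> - 1) * RL_L1fun a \<beta> g s * Gamma \<beta>) absolutely_integrable_on {a..y}"
    unfolding inner by simp
  then show "(\<lambda>s. (y - s) powr (\<alpha> - 1) * RL_L1fun a \<beta> g s) absolutely_integrable_on {a..y}"
    using Gpos set_integrable_mult_left_iff[of "Gamma \<beta>" lebesgue "{a..y}"] by simp
  have "Gamma \<beta> * integral {a..y} (\<lambda>s. (y - s) powr (\<alpha> - 1) * RL_L1fun a \<beta> g s)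
      = integral {a..y} (\<lambda>t. integral {t..y} (\<lambda>s. ?K s t) * g t)"
    using F(2) unfolding inner by (simp add: mult.commute)
  also have "\<dots> = integral {a..y} (\<lambda>t. Beta \<alpha> \<beta> * ((y - t) powr (\<alpha> + \<beta> - 1) * g t))"
    by (intro integral_cong) (use B in \<open>auto simp: integral_unique\<close>)
  also have "\<dots> = Beta \<alpha> \<beta> * integral {a..y} (\<lambda>t. (y - t) powr (\<alpha> + \<beta> - 1) * g t)"
    by simp
  finally show "RL_L1fun a \<alpha> (RL_L1fun a \<beta> g) y = RL_L1fun a (\<alpha> + \<beta>) g y"
    using Gpos unfolding RL_L1fun_def[of a \<alpha>] RL_L1fun_def[of a "\<alpha> + \<beta>"]
    by (simp add: Beta field_simps)
qed

lemma RL_L1fun_1: "RL_L1fun a 1 g x = integral {a..x} g"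
  unfolding RL_L1fun_def
  \<comment> \<open>Because \<open>0 powr 0 = 0\<close>, the kernel of order 1 differs from 1 at the
    single point \<open>t = x\<close>.\<close>
  by (simp, rule integral_spike[of "{x}"]) auto

lemma RL_L1fun_absolutely_integrable:
  assumes "\<beta> > 0" and g: "g absolutely_integrable_on {a..y}"
  shows "RL_L1fun a \<beta> g absolutely_integrable_on {a..y}"
proof -
  \<comment> \<open>The integrability half of the semigroup law with outer order 1, whose weight is
    1 except at \<open>s = y\<close>.\<close>
  have "(\<lambda>s. (y - s) powr (1 - 1) * RL_L1fun a \<beta> g s) absolutely_integrable_on {a..y}"
    by (rule RL_L1fun_semigroup(1)) (use assms in auto)
  moreover have "AE s in lborel. s \<in> {a..y} \<longrightarrow> (y - s) powr (1 - 1) * RL_L1fun a \<beta> g s = RL_L1fun a \<beta> g s"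
    using AE_lborel_singleton[of y] by eventually_elim auto
  ultimately show ?thesis
    by (rule absolutely_integrable_AE[rotated])
qed

section \<open>Riemann-Liouville integrals of continuous functions\<close>

lemma scaled_point_in_interval:
  fixes \<alpha> x a b w :: real
  assumes "\<alpha> > 0" "a \<le> x" "x \<le> b" "w \<in> {0..1}"
  shows "x - (x - a) * w powr (1 / \<alpha>) \<in> {a..b}"
proof -
  have "w powr (1 / \<alpha>) \<le> 1" using assms by (intro powr_le1) auto
  then have "(x - a) * w powr (1 / \<alpha>) \<le> x - a"
    using assms by (simp add: mult_left_le)
  moreover have "0 \<le> (x - a) * w powr (1 / \<alpha>)" using assms by simp
  ultimately show ?thesis using assms by (auto simp del: mult_nonneg_nonneg)
qed

text \<open>The substitution \<open>w = ((x - t) / (x - a)) powr \<alpha>\<close> absorbs the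
  singular kernel. What remains is a continuous integrand over the fixed interval
  \<open>{0..1}\<close>, from which continuity in \<open>x\<close> and sup-norm bounds can be read
  off.\<close>

lemma RL_L1fun_substitution:
  fixes \<alpha> :: real
  assumes "\<alpha> > 0" "a \<le> x" and F: "continuous_on {a..x} F"
  shows "((\<lambda>t. (x - t) powr (\<alpha> - 1) * F t) has_integral
      (x - a) powr \<alpha> / \<alpha> * integral {0..1} (\<lambda>w. F (x - (x - a) * w powr (1 / \<alpha>)))) {a..x}"
proof (cases "a = x")
  case True
  then show ?thesis using has_integral_refl(1) by simp
next
  case False
  define l where "l = x - a"
  have l: "l > 0" using False assms by (simp add: l_def)
  let ?f = "\<lambda>w. F (x - l * w powr (1 / \<alpha>))"
  let ?g = "\<lambda>t. ((x - t) / l) powr \<alpha>"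
  have f: "continuous_on {0..1} ?f"
  proof (rule continuous_on_compose2[OF F])
    show "continuous_on {0..1} (\<lambda>w. x - l * w powr (1 / \<alpha>))"
      using assms by (intro continuous_intros continuous_on_powr') auto
    show "(\<lambda>w. x - l * w powr (1 / \<alpha>)) ` {0..1} \<subseteq> {a..x}"
      using scaled_point_in_interval[of \<alpha> a x x] assms by (auto simp: l_def)
  qed
  have "((\<lambda>t. (- \<alpha> / l * ((x - t) / l) powr (\<alpha> - 1)) *\<^sub>R ?f (?g t)) has_integral
      integral {?g a..?g x} ?f - integral {?g x..?g a} ?f) {a..x}"
  \<comment> \<open>The point \<open>t = x\<close> is exempted from the derivative condition, since
    for \<open>\<alpha> < 1\<close> the substitution has infinite slope there.\<close>
  proof (rule has_integral_substitution_general[OF _ _ _ f])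
    show "?g ` {a..x} \<subseteq> {0..1}"
      using l assms by (auto simp: l_def intro!: powr_le1)
    show "continuous_on {a..x} ?g"
      using l assms by (intro continuous_intros continuous_on_powr') auto
    fix t assume t: "t \<in> {a..x} - {x}"
    show "(?g has_real_derivative - \<alpha> / l * ((x - t) / l) powr (\<alpha> - 1)) (at t within {a..x})"
      using t l by (auto intro!: derivative_eq_intros simp: powr_diff)
  qed (use assms in auto)
  moreover have "?g a = 1" "?g x = 0" using l by (auto simp: l_def)
  ultimately have "((\<lambda>t. (- \<alpha> / l * ((x - t) / l) powr (\<alpha> - 1)) * ?f (?g t)) has_integral
      - integral {0..1} ?f) {a..x}"
    by simp
  from has_integral_mult_right[OF this, of "- (l powr \<alpha>) / \<alpha>"]
  have "((\<lambda>t. - (l powr \<alpha>) / \<alpha> * ((- \<alpha> / l * ((x - t) / l) powr (\<alpha> - 1)) * ?f (?g t))) has_integral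
      (x - a) powr \<alpha> / \<alpha> * integral {0..1} ?f) {a..x}"
    by (simp add: l_def)
  then have "((\<lambda>t. (x - t) powr (\<alpha> - 1) * F t) has_integral (x - a) powr \<alpha> / \<alpha> * integral {0..1} ?f) {a..x}"
  proof (rule has_integral_eq[rotated])
    fix t assume t: "t \<in> {a..x}"
    have 1: "?f (?g t) = F t"
      using t l assms by (simp add: powr_powr)
    have 2: "l powr \<alpha> / l * ((x - t) / l) powr (\<alpha> - 1) = (x - t) powr (\<alpha> - 1)"
      using t l by (simp add: powr_divide powr_diff)
    show "- (l powr \<alpha>) / \<alpha> * ((- \<alpha> / l * ((x - t) / l) powr (\<alpha> - 1)) * ?f (?g t)) = (x - t) powr (\<alpha> - 1) * F t"
      unfolding 1 2[symmetric] using assms by simp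
  qed
  then show ?thesis unfolding l_def .
qed

lemma RL_L1fun_continuous_eq:
  fixes \<alpha> :: real
  assumes "\<alpha> > 0" "a \<le> x" and F: "continuous_on {a..x} F"
  shows "RL_L1fun a \<alpha> F x =
     (x - a) powr \<alpha> / Gamma (\<alpha> + 1) * integral {0..1} (\<lambda>w. F (x - (x - a) * w powr (1 / \<alpha>)))"
proof -
  have "Gamma (\<alpha> + 1) = \<alpha> * Gamma \<alpha>"
    using assms by (intro Gamma_plus1) (auto elim!: nonpos_Ints_cases)
  then show ?thesis
    using integral_unique[OF RL_L1fun_substitution[OF assms]] by (simp add: RL_L1fun_def)
qed

lemma continuous_on_RL_L1fun:
  fixes \<alpha> :: real
  assumes "\<alpha> > 0" and F: "continuous_on {a..b} F"
  shows "continuous_on {a..b} (RL_L1fun a \<alpha> F)"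
proof -
  have "continuous_on ({a..b} \<times> cbox 0 1) (\<lambda>(x, w). F (x - (x - a) * w powr (1 / \<alpha>)))"
    unfolding case_prod_beta
  proof (rule continuous_on_compose2[OF F])
    show "continuous_on ({a..b} \<times> cbox 0 1) (\<lambda>p. fst p - (fst p - a) * snd p powr (1 / \<alpha>))"
      using assms by (intro continuous_intros continuous_on_powr') auto
  qed (use scaled_point_in_interval assms in auto)
  from integral_continuous_on_param[OF this]
  have "continuous_on {a..b} (\<lambda>x. integral {0..1} (\<lambda>w. F (x - (x - a) * w powr (1 / \<alpha>))))"
    by simp
  moreover have Gamma: "Gamma (\<alpha> + 1) \<noteq> 0"
    using Gamma_real_pos[of "\<alpha> + 1"] assms by linarith
  moreover have "continuous_on {a..b} (\<lambda>x. (x - a) powr \<alpha>)"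
    using assms by (intro continuous_intros continuous_on_powr') auto
  ultimately have "continuous_on {a..b} (\<lambda>x. (x - a) powr \<alpha> / Gamma (\<alpha> + 1) *
      integral {0..1} (\<lambda>w. F (x - (x - a) * w powr (1 / \<alpha>))))"
    using Gamma by (intro continuous_on_mult continuous_on_divide continuous_on_const) auto
  then show ?thesis
  proof (rule continuous_on_eq)
    fix x assume "x \<in> {a..b}"
    then show "(x - a) powr \<alpha> / Gamma (\<alpha> + 1) * integral {0..1} (\<lambda>w. F (x - (x - a) * w powr (1 / \<alpha>)))
        = RL_L1fun a \<alpha> F x"
      using assms by (intro RL_L1fun_continuous_eq[symmetric]) (auto intro: continuous_on_subset[OF F])
  qed
qed

text \<open>Boundedness of the fractional integral in the supremum norm, in difference form: after
  the substitution the difference is a prefactor, increasing in \<open>x\<close>, times an average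
  of values of \<open>F - G\<close>.\<close>

lemma RL_L1fun_diff_bound:
  fixes \<alpha> :: real
  assumes "\<alpha> > 0" "x \<in> {a..b}" and F: "continuous_on {a..b} F" and G: "continuous_on {a..b} G"
    and M: "\<And>t. t \<in> {a..b} \<Longrightarrow> \<bar>F t - G t\<bar> \<le> M"
  shows "\<bar>RL_L1fun a \<alpha> F x - RL_L1fun a \<alpha> G x\<bar> \<le> (b - a) powr \<alpha> / Gamma (\<alpha> + 1) * M"
proof -
  have sub: "continuous_on {a..x} F" "continuous_on {a..x} G"
    using assms by (auto intro: continuous_on_subset[OF F] continuous_on_subset[OF G])
  let ?p = "\<lambda>w. x - (x - a) * w powr (1 / \<alpha>)"
  have p: "continuous_on {0..1} (\<lambda>w. H (?p w))" if "continuous_on {a..b} H" for H :: "real \<Rightarrow> real"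
  proof (rule continuous_on_compose2[OF that])
    show "continuous_on {0..1} ?p"
      using assms by (intro continuous_intros continuous_on_powr') auto
  qed (use scaled_point_in_interval assms in auto)
  have int: "(\<lambda>w. F (?p w)) integrable_on {0..1}" "(\<lambda>w. G (?p w)) integrable_on {0..1}"
    by (intro integrable_continuous_interval p F G)+
  have "RL_L1fun a \<alpha> F x - RL_L1fun a \<alpha> G x =
     (x - a) powr \<alpha> / Gamma (\<alpha> + 1) * integral {0..1} (\<lambda>w. F (?p w) - G (?p w))"
    using assms sub int
    by (simp add: RL_L1fun_continuous_eq right_diff_distrib Henstock_Kurzweil_Integration.integral_diff)
  moreover have "norm (integral {0..1} (\<lambda>w. F (?p w) - G (?p w))) \<le> M * (1 - 0)"
  proof (rule integral_bound)
    show "continuous_on {0..1} (\<lambda>w. F (?p w) - G (?p w))"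
      by (intro continuous_on_diff p F G)
    show "norm (F (?p w) - G (?p w)) \<le> M" if "w \<in> {0..1}" for w
      unfolding real_norm_def using that assms by (intro M scaled_point_in_interval) auto
  qed auto
  moreover have "(x - a) powr \<alpha> / Gamma (\<alpha> + 1) \<le> (b - a) powr \<alpha> / Gamma (\<alpha> + 1)"
    using assms by (intro divide_right_mono powr_mono2) (auto intro!: less_imp_le Gamma_real_pos)
  moreover have "0 \<le> (x - a) powr \<alpha> / Gamma (\<alpha> + 1)"
    using assms by (auto intro!: divide_nonneg_pos Gamma_real_pos)
  ultimately show ?thesis
    by (simp only: abs_mult real_norm_def, intro mult_mono) auto
qed

subsection \<open>Primitives of distributions\<close>

lemma deq_refl: "deq a b S S"
  by (simp add: deq_def)

lemma deq_sym: "deq a b S T \<Longrightarrow> deq a b T S"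
  by (simp add: deq_def)

lemma deq_trans [trans]: "deq a b S T \<Longrightarrow> deq a b T U \<Longrightarrow> deq a b S U"
  by (simp add: deq_def)

lemma deq_dD: "deq a b S T \<Longrightarrow> deq a b (dD S) (dD T)"
  by (simp add: deq_def dD_def test_fun_deriv)

lemma deq_funpow_dD: "deq a b S T \<Longrightarrow> deq a b ((dD ^^ m) S) ((dD ^^ m) T)"
  by (induction m) (auto intro: deq_dD)

lemma reg_cong: "(\<And>x. x \<in> {a..b} \<Longrightarrow> F x = G x) \<Longrightarrow> reg a b F = reg a b G"
  unfolding reg_def by (intro ext integral_cong) simp

lemma continuous_mult_deriv_integrable:
  assumes "continuous_on {a..b} F" "test_fun a b \<phi>"
  shows "(\<lambda>x. F x * deriv \<phi> x) integrable_on {a..b}"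
  using assms
  by (intro integrable_continuous_interval continuous_intros continuous_on_test_fun[OF test_fun_deriv])

lemma is_prim_cong:
  assumes "is_prim a b f F" "\<And>x. x \<in> {a..b} \<Longrightarrow> F x = G x" "a < b"
  shows "is_prim a b f G"
  using assms reg_cong[of a b F G] continuous_on_cong[of "{a..b}" "{a..b}" F G]
  by (auto simp: is_prim_def C0_def)

lemma is_prim_deq: "is_prim a b f F \<Longrightarrow> deq a b f (dD (reg a b F))"
  by (simp add: is_prim_def)

lemma is_prim_dD_reg: "F \<in> C0 a b \<Longrightarrow> is_prim a b (dD (reg a b F)) F"
  by (simp add: is_prim_def deq_refl)

lemma is_prim_reg:
  assumes "a < b" and g: "g absolutely_integrable_on {a..b}"
  shows "is_prim a b (reg a b g) (\<lambda>x. integral {a..x} g)"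
  unfolding is_prim_def
proof
  show "(\<lambda>x. integral {a..x} g) \<in> C0 a b"
    using g by (auto simp: C0_def absolutely_integrable_on_def intro: indefinite_integral_continuous_1)
  show "deq a b (reg a b g) (dD (reg a b (\<lambda>x. integral {a..x} g)))"
    unfolding deq_def dD_def reg_def
  proof (intro allI impI)
    fix \<phi> assume \<phi>: "test_fun a b \<phi>"
    show "integral {a..b} (\<lambda>x. g x * \<phi> x) = - integral {a..b} (\<lambda>x. integral {a..x} g * deriv \<phi> x)"
      using indefinite_integral_by_parts[OF g test_fun_has_derivative[OF \<phi>]
          continuous_on_test_fun[OF test_fun_deriv[OF \<phi>]]] test_fun_eq_0[OF \<phi>]
      by simp
  qed
qed

lemma is_prim_dminus:
  assumes "is_prim a b S F" "is_prim a b T G"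
  shows "is_prim a b (dminus S T) (\<lambda>x. F x - G x)"
  unfolding is_prim_def
proof
  have c: "continuous_on {a..b} F" "continuous_on {a..b} G" "F a = 0" "G a = 0"
    using assms by (auto simp: is_prim_def C0_def)
  then show "(\<lambda>x. F x - G x) \<in> C0 a b"
    by (auto simp: C0_def intro: continuous_intros)
  show "deq a b (dminus S T) (dD (reg a b (\<lambda>x. F x - G x)))"
    unfolding deq_def
  proof (intro allI impI)
    fix \<phi> assume \<phi>: "test_fun a b \<phi>"
    have "S \<phi> = dD (reg a b F) \<phi>" "T \<phi> = dD (reg a b G) \<phi>"
      using assms \<phi> by (auto simp: is_prim_def deq_def)
    then show "dminus S T \<phi> = dD (reg a b (\<lambda>x. F x - G x)) \<phi>"
      using Henstock_Kurzweil_Integration.integral_diff[OF continuous_mult_deriv_integrable[OF c(1) \<phi>]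
          continuous_mult_deriv_integrable[OF c(2) \<phi>]]
      by (simp add: dminus_def dD_def reg_def left_diff_distrib)
  qed
qed

text \<open>The difference of two primitives is a primitive of the zero functional, hence constant
  by du Bois-Reymond, and it vanishes at \<open>a\<close>.\<close>

lemma is_prim_unique:
  assumes F: "is_prim a b f F" and G: "is_prim a b f G" and "a < b" "x \<in> {a..b}"
  shows "F x = G x"
proof -
  have "is_prim a b (dminus f f) (\<lambda>x. F x - G x)"
    by (rule is_prim_dminus[OF F G])
  then have H: "continuous_on {a..b} (\<lambda>x. F x - G x)" "F a - G a = 0"
    and d: "deq a b (dminus f f) (dD (reg a b (\<lambda>x. F x - G x)))"
    by (auto simp: is_prim_def C0_def)
  have "integral {a..b} (\<lambda>x. (F x - G x) * deriv \<phi> x) = 0" if "test_fun a b \<phi>" for \<phi>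
    using d that unfolding deq_def dminus_def dD_def reg_def by fastforce
  from du_Bois_Reymond[OF H(1) this assms(3,4)] H(2) show ?thesis by simp
qed

lemma prim_eq:
  assumes F: "is_prim a b f F" and "a < b"
  shows "prim a b f = (\<lambda>x. if x \<in> {a..b} then F x else 0)"
  unfolding prim_def
proof (rule the_equality)
  show "is_prim a b f (\<lambda>x. if x \<in> {a..b} then F x else 0) \<and>
      (\<forall>x. x \<notin> {a..b} \<longrightarrow> (if x \<in> {a..b} then F x else 0) = 0)"
    using is_prim_cong[OF F _ \<open>a < b\<close>] by auto
next
  fix G assume "is_prim a b f G \<and> (\<forall>x. x \<notin> {a..b} \<longrightarrow> G x = 0)"
  then show "G = (\<lambda>x. if x \<in> {a..b} then F x else 0)"
    using is_prim_unique[OF _ F \<open>a < b\<close>, of G] by (intro ext) auto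
qed

section \<open>The Alexiewicz norm\<close>

lemma alex_eq:
  assumes "is_prim a b f F" "a < b"
  shows "alex a b f = (SUP x\<in>{a..b}. \<bar>F x\<bar>)"
  unfolding alex_def prim_eq[OF assms] by (intro SUP_cong) auto

lemma abs_le_alex:
  assumes F: "is_prim a b f F" and "a < b" "x \<in> {a..b}"
  shows "\<bar>F x\<bar> \<le> alex a b f"
proof -
  have "continuous_on {a..b} F" using F by (simp add: is_prim_def C0_def)
  then have "bounded ((\<lambda>x. \<bar>F x\<bar>) ` {a..b})"
    by (intro compact_imp_bounded compact_continuous_image continuous_intros) auto
  then have "bdd_above ((\<lambda>x. \<bar>F x\<bar>) ` {a..b})"
    by (rule bounded_imp_bdd_above)
  then show ?thesis
    unfolding alex_eq[OF F \<open>a < b\<close>] using assms by (intro cSUP_upper)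
qed

lemma alex_le:
  assumes "is_prim a b f F" "a < b" "\<And>x. x \<in> {a..b} \<Longrightarrow> \<bar>F x\<bar> \<le> M"
  shows "alex a b f \<le> M"
  unfolding alex_eq[OF assms(1,2)] using assms by (intro cSUP_least) auto

lemma alex_nonneg:
  assumes "is_prim a b f F" "a < b"
  shows "0 \<le> alex a b f"
  using abs_le_alex[OF assms, of a] assms by force

section \<open>Fractional integrals of distributions\<close>

lemma RL_L1fun_in_C0:
  assumes "\<alpha> > 0" "continuous_on {a..b} F"
  shows "RL_L1fun a \<alpha> F \<in> C0 a b"
  using continuous_on_RL_L1fun[OF assms] by (simp add: C0_def RL_L1fun_def)

text \<open>By the semigroup law, integrating commutes with taking the integral of order \<open>\<beta>\<close>.\<close>

lemma is_prim_reg_RL_L1fun: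
  assumes "a < b" "\<beta> > 0" and g: "g absolutely_integrable_on {a..b}"
  shows "is_prim a b (reg a b (RL_L1fun a \<beta> g)) (RL_L1fun a \<beta> (\<lambda>x. integral {a..x} g))"
proof (rule is_prim_cong[OF is_prim_reg[OF \<open>a < b\<close> RL_L1fun_absolutely_integrable[OF \<open>\<beta> > 0\<close> g]]])
  fix x assume "x \<in> {a..b}"
  then have gx: "g absolutely_integrable_on {a..x}"
    using g by (intro absolutely_integrable_on_subinterval[OF g]) auto
  have "integral {a..x} (RL_L1fun a \<beta> g) = RL_L1fun a (1 + \<beta>) g x"
    using RL_L1fun_semigroup(2)[of 1 \<beta>, OF _ _ _ gx] assms by (simp add: RL_L1fun_1)
  also have "\<dots> = RL_L1fun a \<beta> (RL_L1fun a 1 g) x"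
    using RL_L1fun_semigroup(2)[of \<beta> 1, OF _ _ _ gx] assms by (simp add: add.commute)
  finally show "integral {a..x} (RL_L1fun a \<beta> g) = RL_L1fun a \<beta> (\<lambda>x. integral {a..x} g) x"
    by (simp add: RL_L1fun_1[abs_def])
qed fact

lemma L1_dense:
  assumes "a < b" and F: "is_prim a b f F"
  shows "\<exists>fk :: nat \<Rightarrow> real \<Rightarrow> real. (\<forall>k. fk k absolutely_integrable_on {a..b}) \<and>
    (\<lambda>k. alex a b (dminus (reg a b (fk k)) f)) \<longlonglongrightarrow> 0"
proof -
  \<comment> \<open>The derivative of a polynomial uniformly close to \<open>F\<close> serves as
    \<open>g\<close>. Its primitive is \<open>p x - p a\<close>, and \<open>p a\<close> is only
    close to \<open>F a = 0\<close>, so the error is counted twice.\<close>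
  have "\<exists>g. g absolutely_integrable_on {a..b} \<and> alex a b (dminus (reg a b g) f) \<le> 2 * inverse (real (Suc k))" for k
  proof -
    have cF: "continuous_on {a..b} F" "F a = 0" using F by (auto simp: is_prim_def C0_def)
    obtain p where p: "real_polynomial_function p" "\<And>x. x \<in> {a..b} \<Longrightarrow> \<bar>F x - p x\<bar> < inverse (real (Suc k))"
      using Stone_Weierstrass_real_polynomial_function[OF _ cF(1), of "inverse (real (Suc k))"] by auto
    obtain p' where p': "real_polynomial_function p'" "\<And>x. (p has_real_derivative p' x) (at x)"
      using has_real_derivative_polynomial_function[OF p(1)] by blast
    have "continuous_on {a..b} p'"
      using p'(1) continuous_on_polymonial_function real_polynomial_function_eq by blast
    then have int: "p' absolutely_integrable_on {a..b}"
      by (rule absolutely_integrable_continuous_real)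
    have "alex a b (dminus (reg a b p') f) \<le> 2 * inverse (real (Suc k))"
    proof (rule alex_le[OF is_prim_dminus[OF is_prim_reg[OF \<open>a < b\<close> int] F] \<open>a < b\<close>])
      fix x assume x: "x \<in> {a..b}"
      have "(p' has_integral p x - p a) {a..x}"
        using x p'(2) by (intro fundamental_theorem_of_calculus)
          (auto simp: has_real_derivative_iff_has_vector_derivative[symmetric] has_field_derivative_at_within)
      then have "integral {a..x} p' = p x - p a" by (rule integral_unique)
      then show "\<bar>integral {a..x} p' - F x\<bar> \<le> 2 * inverse (real (Suc k))"
        using p(2)[OF x] p(2)[of a] cF(2) \<open>a < b\<close> by auto
    qed
    with int show ?thesis by blast
  qed
  then obtain fk where fk: "\<And>k. fk k absolutely_integrable_on {a..b}"
    "\<And>k. alex a b (dminus (reg a b (fk k)) f) \<le> 2 * inverse (real (Suc k))"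
    by metis
  have "(\<lambda>k. alex a b (dminus (reg a b (fk k)) f)) \<longlonglongrightarrow> 0"
  proof (rule tendsto_sandwich[OF _ _ tendsto_const])
    show "\<forall>\<^sub>F k in sequentially. 0 \<le> alex a b (dminus (reg a b (fk k)) f)"
      using alex_nonneg[OF is_prim_dminus[OF is_prim_reg[OF \<open>a < b\<close> fk(1)] F] \<open>a < b\<close>] by simp
    show "\<forall>\<^sub>F k in sequentially. alex a b (dminus (reg a b (fk k)) f) \<le> 2 * inverse (real (Suc k))"
      using fk(2) by simp
    show "(\<lambda>k. 2 * inverse (real (Suc k))) \<longlonglongrightarrow> 0"
      using tendsto_mult_right_zero[OF LIMSEQ_inverse_real_of_nat] by simp
  qed
  with fk(1) show ?thesis by blast
qed

text \<open>The definite description is resolved by showing that the integral of the primitive has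
  the required limit property, by the sup-norm bound, and that no other function has it, by
  density.\<close>

lemma RL_small_eq:
  assumes "a < b" "\<beta> > 0" and F: "is_prim a b f F"
  shows "RL_small a b \<beta> f = dD (reg a b (RL_L1fun a \<beta> F))"
proof -
  have cF: "continuous_on {a..b} F" "F a = 0" using F by (auto simp: is_prim_def C0_def)
  define H0 where "H0 = (\<lambda>x. if x \<in> {a..b} then RL_L1fun a \<beta> F x else 0)"
  have "H0 \<in> C0 a b"
    using RL_L1fun_in_C0[OF \<open>\<beta> > 0\<close> cF(1)] continuous_on_cong[of "{a..b}" "{a..b}" H0 "RL_L1fun a \<beta> F"] \<open>a < b\<close>
    by (auto simp: H0_def C0_def)
  define \<Phi> where "\<Phi> = (\<lambda>g x. integral {a..x} g :: real)"
  have diff: "is_prim a b (dminus (reg a b (RL_L1fun a \<beta> g)) (dD (reg a b H))) (\<lambda>x. RL_L1fun a \<beta> (\<Phi> g) x - H x)"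
    if "g absolutely_integrable_on {a..b}" "H \<in> C0 a b" for g H
    unfolding \<Phi>_def
    by (intro is_prim_dminus is_prim_reg_RL_L1fun is_prim_dD_reg assms that)
  define approx where "approx = (\<lambda>fk :: nat \<Rightarrow> real \<Rightarrow> real. (\<forall>k. fk k absolutely_integrable_on {a..b}) \<and>
        (\<lambda>k. alex a b (dminus (reg a b (fk k)) f)) \<longlonglongrightarrow> 0)"
  define good where "good = (\<lambda>H. \<forall>fk. approx fk \<longrightarrow>
        (\<lambda>k. alex a b (dminus (reg a b (RL_L1fun a \<beta> (fk k))) (dD (reg a b H)))) \<longlonglongrightarrow> 0)"
  have good_H0: "good H0"
    unfolding good_def
  proof (intro allI impI)
    fix fk assume "approx fk"
    then have fk: "\<And>k. fk k absolutely_integrable_on {a..b}"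
      and lim: "(\<lambda>k. alex a b (dminus (reg a b (fk k)) f)) \<longlonglongrightarrow> 0"
      by (auto simp: approx_def)
    let ?C = "(b - a) powr \<beta> / Gamma (\<beta> + 1)"
    let ?d = "\<lambda>k. alex a b (dminus (reg a b (RL_L1fun a \<beta> (fk k))) (dD (reg a b H0)))"
    have "?d k \<le> ?C * alex a b (dminus (reg a b (fk k)) f)" for k
    proof (rule alex_le[OF diff[OF fk \<open>H0 \<in> C0 a b\<close>] \<open>a < b\<close>])
      fix x assume x: "x \<in> {a..b}"
      have P: "is_prim a b (reg a b (fk k)) (\<Phi> (fk k))"
        unfolding \<Phi>_def by (rule is_prim_reg[OF \<open>a < b\<close> fk])
      then have "continuous_on {a..b} (\<Phi> (fk k))" by (simp add: is_prim_def C0_def)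
      from RL_L1fun_diff_bound[OF \<open>\<beta> > 0\<close> x this cF(1) abs_le_alex[OF is_prim_dminus[OF P F] \<open>a < b\<close>]]
      show "\<bar>RL_L1fun a \<beta> (\<Phi> (fk k)) x - H0 x\<bar> \<le> ?C * alex a b (dminus (reg a b (fk k)) f)"
        using x by (simp add: H0_def)
    qed
    moreover have "0 \<le> ?d k" for k
      by (rule alex_nonneg[OF diff[OF fk \<open>H0 \<in> C0 a b\<close>] \<open>a < b\<close>])
    ultimately show "?d \<longlonglongrightarrow> 0"
      by (intro tendsto_sandwich[OF always_eventually always_eventually tendsto_const
            tendsto_mult_right_zero[OF lim, of ?C]] allI)
  qed
  \<comment> \<open>Both candidates are pointwise limits of the same sequence. One approximating
    sequence must exist for this, since otherwise the limit property would hold vacuously for every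
    \<open>H\<close>.\<close>
  have unique: "H = H0" if H: "H \<in> C0 a b" "\<forall>x. x \<notin> {a..b} \<longrightarrow> H x = 0" "good H" for H
  proof
    fix x
    obtain fk where "approx fk"
      unfolding approx_def using L1_dense[OF \<open>a < b\<close> F] ..
    then have fk: "\<And>k. fk k absolutely_integrable_on {a..b}" by (simp add: approx_def)
    have lim: "(\<lambda>k. RL_L1fun a \<beta> (\<Phi> (fk k)) x - K x) \<longlonglongrightarrow> 0"
      if "good K" "K \<in> C0 a b" "x \<in> {a..b}" for K
    proof (rule Lim_null_comparison)
      show "(\<lambda>k. alex a b (dminus (reg a b (RL_L1fun a \<beta> (fk k))) (dD (reg a b K)))) \<longlonglongrightarrow> 0"
        using that \<open>approx fk\<close> by (simp add: good_def)
    qed (use abs_le_alex[OF diff[OF fk that(2)] \<open>a < b\<close> that(3)] in auto)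
    show "H x = H0 x"
    proof (cases "x \<in> {a..b}")
      case True
      from tendsto_diff[OF lim[OF H(3,1) True] lim[OF good_H0 \<open>H0 \<in> C0 a b\<close> True]]
      have "(\<lambda>k::nat. H0 x - H x) \<longlonglongrightarrow> 0" by simp
      then show ?thesis by (simp add: LIMSEQ_const_iff)
    qed (use H(2) in \<open>auto simp: H0_def\<close>)
  qed
  have "RL_small a b \<beta> f = dD (reg a b (THE H. H \<in> C0 a b \<and> (\<forall>x. x \<notin> {a..b} \<longrightarrow> H x = 0) \<and> good H))"
    by (simp add: RL_small_def good_def approx_def)
  also have "(THE H. H \<in> C0 a b \<and> (\<forall>x. x \<notin> {a..b} \<longrightarrow> H x = 0) \<and> good H) = H0"
  proof (rule the_equality)
    show "H0 \<in> C0 a b \<and> (\<forall>x. x \<notin> {a..b} \<longrightarrow> H0 x = 0) \<and> good H0"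
      using \<open>H0 \<in> C0 a b\<close> good_H0 by (simp add: H0_def)
  qed (elim conjE, rule unique)
  also have "reg a b H0 = reg a b (RL_L1fun a \<beta> F)"
    by (rule reg_cong) (simp add: H0_def)
  finally show ?thesis .
qed

lemma RL_big_eq:
  assumes "a < b" "n \<ge> 1" and F: "is_prim a b f F"
  shows "RL_big a b n f = reg a b (if n = 1 then F else RL_L1fun a (n - 1) F)"
  unfolding RL_big_def
proof (rule reg_cong)
  fix x assume x: "x \<in> {a..b}"
  have "F a = 0" using F by (simp add: is_prim_def C0_def)
  have pint: "integral {a..x} (\<lambda>t. prim a b f t * g t) = integral {a..x} (\<lambda>t. F t * g t)" for g
    using x by (intro integral_cong) (simp add: prim_eq[OF F \<open>a < b\<close>])
  show "hk_int_mult a b f (kern n x) (kern' n x) a x / Gamma n = (if n = 1 then F else RL_L1fun a (n - 1) F) x"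
  proof (cases "n = 1")
    case True
    then show ?thesis
      using x \<open>F a = 0\<close> by (simp add: hk_int_mult_def kern_def kern'_def prim_eq[OF F \<open>a < b\<close>])
  next
    case False
    then have "n > 1" using assms by simp
    have "Gamma n = (n - 1) * Gamma (n - 1)"
      using Gamma_plus1[of "n - 1"] nonpos_Ints_nonpos[of "n - 1"] \<open>n > 1\<close> by force
    \<comment> \<open>The boundary terms vanish: at \<open>t = x\<close> because the kernel is 0
      there for \<open>n > 1\<close>, at \<open>t = a\<close> because \<open>F a = 0\<close>. The
      factor \<open>n - 1\<close> of \<open>kern'\<close> is later cancelled against
      \<open>Gamma n\<close>.\<close>
    moreover have "hk_int_mult a b f (kern n x) (kern' n x) a x = - integral {a..x} (\<lambda>t. F t * kern' n x t)"
      using x \<open>n > 1\<close> \<open>F a = 0\<close> by (simp add: hk_int_mult_def pint) (simp add: kern_def prim_eq[OF F \<open>a < b\<close>])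
    moreover have "(\<lambda>t. F t * kern' n x t) = (\<lambda>t. - (n - 1) * ((x - t) powr (n - 1 - 1) * F t))"
      by (auto simp: kern'_def)
    ultimately show ?thesis
      using \<open>n > 1\<close> by (simp add: RL_L1fun_def del: minus_diff_eq)
  qed
qed

text \<open>For \<open>n \<ge> 1\<close> the distribution is the function of order
  \<open>n - 1\<close> applied to \<open>F\<close> (or \<open>F\<close> itself), and one more
  integration raises the order to \<open>n\<close>; for \<open>n < 1\<close> the primitive is
  supplied by the definition of the limit.\<close>

lemma is_prim_RLJ:
  assumes "a < b" "n > 0" and F: "is_prim a b f F"
  shows "is_prim a b (RLJ a b n f) (RL_L1fun a n F)"
proof (cases "n \<ge> 1")
  case False
  have "continuous_on {a..b} F" using F by (simp add: is_prim_def C0_def)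
  then show ?thesis
    using False assms RL_small_eq[OF \<open>a < b\<close> \<open>n > 0\<close> F]
    by (simp add: RLJ_def is_prim_dD_reg RL_L1fun_in_C0)
next
  case True
  let ?G = "if n = 1 then F else RL_L1fun a (n - 1) F"
  have cF: "continuous_on {a..b} F" using F by (simp add: is_prim_def C0_def)
  then have "continuous_on {a..b} ?G"
    using True by (auto intro: continuous_on_RL_L1fun)
  then have "is_prim a b (reg a b ?G) (\<lambda>x. integral {a..x} ?G)"
    using \<open>a < b\<close> by (intro is_prim_reg absolutely_integrable_continuous_real)
  then have "is_prim a b (reg a b ?G) (RL_L1fun a n F)"
  proof (rule is_prim_cong)
    fix x assume "x \<in> {a..b}"
    then have "F absolutely_integrable_on {a..x}"
      using cF by (intro absolutely_integrable_continuous_real) (auto elim: continuous_on_subset)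
    then show "integral {a..x} ?G = RL_L1fun a n F x"
      using True RL_L1fun_semigroup(2)[of 1 "n - 1" a x F] by (auto simp: RL_L1fun_1)
  qed fact
  then show ?thesis
    using True RL_big_eq[OF \<open>a < b\<close> True F] by (simp add: RLJ_def)
qed

section \<open>Repeated differentiation and the inversion theorem\<close>

lemma dD_reg_RL_L1fun_1:
  assumes "a < b" "continuous_on {a..b} G"
  shows "deq a b (dD (reg a b (RL_L1fun a 1 G))) (reg a b G)"
  using is_prim_deq[OF is_prim_reg[OF \<open>a < b\<close> absolutely_integrable_continuous_real[OF assms(2)]]]
  by (simp add: RL_L1fun_1[abs_def] deq_sym)

lemma funpow_dD_reg_RL_L1fun:
  assumes "a < b" and F: "continuous_on {a..b} F"
  shows "deq a b ((dD ^^ Suc m) (reg a b (RL_L1fun a (real (Suc m)) F))) (reg a b F)"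
proof (induction m)
  case 0
  then show ?case using dD_reg_RL_L1fun_1[OF assms] by simp
next
  case (Suc m)
  let ?G = "RL_L1fun a (real (Suc m)) F"
  have "reg a b (RL_L1fun a (real (Suc (Suc m))) F) = reg a b (RL_L1fun a 1 ?G)"
  proof (rule reg_cong)
    fix x assume "x \<in> {a..b}"
    then have "F absolutely_integrable_on {a..x}"
      using F by (intro absolutely_integrable_continuous_real) (auto elim: continuous_on_subset)
    then show "RL_L1fun a (real (Suc (Suc m))) F x = RL_L1fun a 1 ?G x"
      using RL_L1fun_semigroup(2)[of 1 "real (Suc m)" a x F] by simp
  qed
  moreover have "deq a b ((dD ^^ Suc m) (dD (reg a b (RL_L1fun a 1 ?G)))) ((dD ^^ Suc m) (reg a b ?G))"
    by (intro deq_funpow_dD dD_reg_RL_L1fun_1 continuous_on_RL_L1fun assms) simp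
  ultimately show ?case
    using deq_trans[OF _ Suc.IH] by (simp only: funpow_Suc_right[of "Suc m"] comp_apply)
qed

theorem theorem4p11:
  fixes a b n :: real and f :: distr
  assumes "a < b" and "0 \<le> n" and "f \<in> HK a b"
  shows "deq a b (RLD a b n (RLJ a b n f)) f"
proof (cases "n = 0")
  case True
  then show ?thesis by (simp add: RLD_def RLJ_def deq_refl)
next
  case False
  then have "n > 0" using assms by simp
  obtain F where F: "is_prim a b f F" using assms by (auto simp: HK_def)
  then have cF: "continuous_on {a..b} F" by (simp add: is_prim_def C0_def)
  define m where "m = nat \<lceil>n\<rceil> - 1"
  have m: "nat \<lceil>n\<rceil> = Suc m" using \<open>n > 0\<close> by (simp add: m_def)
  have mn: "n \<le> real (Suc m)" "real (Suc m) < n + 1"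
    unfolding m[symmetric] using \<open>n > 0\<close> by (auto simp: of_nat_nat) linarith+
  let ?H = "RL_L1fun a n F" and ?J = "reg a b (RL_L1fun a (real (Suc m)) F)"
  have H: "is_prim a b (RLJ a b n f) ?H"
    by (rule is_prim_RLJ[OF \<open>a < b\<close> \<open>n > 0\<close> F])
  \<comment> \<open>The orders add up to the integer \<open>Suc m\<close>. The \<open>dD\<close> on
    the right is there because the fractional integrals act on the primitive of \<open>f\<close> and
    not on \<open>f\<close>.\<close>
  have "deq a b (RLJ a b (real (Suc m) - n) (RLJ a b n f)) (dD ?J)"
  \<comment> \<open>For integer \<open>n\<close> the remaining order is 0, where the fractional
    integral is the identity by definition; otherwise it lies strictly between 0 and 1.\<close>
  proof (cases "real (Suc m) = n")
    case True
    then show ?thesis using is_prim_deq[OF H] by (simp add: RLJ_def[of a b 0])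
  next
    case False
    define \<beta> where "\<beta> = real (Suc m) - n"
    have \<beta>: "0 < \<beta>" "\<beta> < 1" "\<beta> + n = real (Suc m)"
      using False mn by (auto simp: \<beta>_def)
    have "reg a b (RL_L1fun a \<beta> ?H) = ?J"
    proof (rule reg_cong)
      fix x assume "x \<in> {a..b}"
      then have "F absolutely_integrable_on {a..x}"
        using cF by (intro absolutely_integrable_continuous_real) (auto elim: continuous_on_subset)
      then show "RL_L1fun a \<beta> ?H x = RL_L1fun a (real (Suc m)) F x"
        using RL_L1fun_semigroup(2)[of \<beta> n a x F] \<beta> \<open>n > 0\<close> by simp
    qed
    then show ?thesis
      using \<beta> RL_small_eq[OF \<open>a < b\<close> \<beta>(1) H]
      unfolding \<beta>_def[symmetric] by (simp add: RLJ_def[of a b \<beta>] deq_refl)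
  qed
  then have "deq a b (RLD a b n (RLJ a b n f)) ((dD ^^ Suc m) (dD ?J))"
    unfolding RLD_def m by (rule deq_funpow_dD)
  \<comment> \<open>Moving the extra derivative outermost lets the other \<open>Suc m\<close> cancel
    the integral of order \<open>Suc m\<close>, leaving the derivative of \<open>F\<close>.\<close>
  also have "(dD ^^ Suc m) (dD ?J) = dD ((dD ^^ Suc m) ?J)"
    by (simp only: funpow_swap1)
  also have "deq a b \<dots> (dD (reg a b F))"
    by (rule deq_dD[OF funpow_dD_reg_RL_L1fun[OF \<open>a < b\<close> cF]])
  also have "deq a b (dD (reg a b F)) f"
    by (rule deq_sym[OF is_prim_deq[OF F]])
  finally show ?thesis .
qed

end
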